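(* The only minimal flat slant surfaces in a Lorentzian complex space form $\tilde M^2_1(4c)$ with $c\neq0$ are the Lagrangian ones; that is, every minimal flat slant surface in $\tilde M^2_1(4c)$, $c\ne0$, is Lagrangian.
   Context: A Lorentzian complex space form $\tilde M^2_1(4c)$ is a Kähler manifold of complex dimension $2$ and complex index $1$ (real signature $(2,2)$), with metric $\langle\,,\rangle$ and complex structure $J$, whose curvature tensor is $$\tilde R(X,Y)Z=c\{\langle Y,Z\rangle X-\langle X,Z\rangle Y+\langle JY,Z\rangle JX-\langle JX,Z\rangle JY+2\langle X,JY\rangle JZ\}.$$ A Lorentzian surface is an immersed real surface whose induced metric has signature $(1,1)$; it is minimal if its mean curvature vector $H=\frac12\operatorname{trace}h$ ($h$ the second fundamental form) vanishes identically, and flat if the induced metric is flat. On a Lorentzian surface take a local tangent frame $\{e_1,e_2\}$ with $\langle e_1,e_1\rangle=\langle e_2,e_2\rangle=0$, $\langle e_1,e_2\rangle=-1$; writing $PX$ for the tangential component of $JX$, one has $Pe_1=(\sinh\alpha)e_1$, $Pe_2=-(\sinh\alpha)e_2$ for a function $\alpha$, the Wirtinger angle. A Lorentzian surface is slant if $\alpha$ is constant, and it is Lagrangian if and only if $\alpha=0$. *)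

theory Defs
  imports "HOL-Analysis.Analysis"
begin

section \<open>Smooth maps between open subsets of Euclidean spaces\<close>

abbreviation Der :: "('a::real_normed_vector \<Rightarrow> 'b::real_normed_vector) \<Rightarrow> 'a \<Rightarrow> 'a \<Rightarrow> 'b" where
  "Der f p v \<equiv> frechet_derivative f (at p) v"

text \<open>These are meant for open \<open>S\<close> only.\<close>

primrec Ck_on :: "nat \<Rightarrow> 'a::euclidean_space set \<Rightarrow> ('a \<Rightarrow> 'b::real_normed_vector) \<Rightarrow> bool" where
  "Ck_on 0 S f \<longleftrightarrow> continuous_on S f"
| "Ck_on (Suc k) S f \<longleftrightarrow>
     (\<forall>p\<in>S. f differentiable (at p)) \<and> (\<forall>v. Ck_on k S (\<lambda>p. Der f p v))"

definition smooth_on :: "'a::euclidean_space set \<Rightarrow> ('a \<Rightarrow> 'b::real_normed_vector) \<Rightarrow> bool" where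
  "smooth_on S f \<longleftrightarrow> (\<forall>k. Ck_on k S f)"


section \<open>Pseudo-Riemannian metrics in one coordinate domain\<close>

text \<open>
  A metric in a coordinate domain is a function \<open>g\<close>, where \<open>g p X Y\<close> is the scalar product at
  the point with coordinates \<open>p\<close> of the tangent vectors with components \<open>X\<close> and \<open>Y\<close>.
\<close>

type_synonym 'e metric = "'e \<Rightarrow> 'e \<Rightarrow> 'e \<Rightarrow> real"

definition scalar_product :: "('e::euclidean_space \<Rightarrow> 'e \<Rightarrow> real) \<Rightarrow> bool" where
  "scalar_product b \<longleftrightarrow> bilinear b \<and> (\<forall>X Y. b X Y = b Y X) \<and>
     (\<forall>X. (\<forall>Y. b X Y = 0) \<longrightarrow> X = 0)"

definition metric_index :: "('e::euclidean_space \<Rightarrow> 'e \<Rightarrow> real) \<Rightarrow> nat" where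
  "metric_index b = Max (dim ` {W. subspace W \<and> (\<forall>v\<in>W. v \<noteq> 0 \<longrightarrow> b v v < 0)})"

definition metric_on :: "'e::euclidean_space set \<Rightarrow> 'e metric \<Rightarrow> bool" where
  "metric_on S g \<longleftrightarrow> (\<forall>p\<in>S. scalar_product (g p)) \<and> (\<forall>X Y. smooth_on S (\<lambda>p. g p X Y))"

text \<open>
  The Christoffel symbols \<open>\<Gamma>\<close> of the Levi-Civita connection, as the vector-valued
  bilinear map determined by the Koszul formula for constant coordinate fields.
\<close>

definition christoffel :: "'e::euclidean_space metric \<Rightarrow> 'e \<Rightarrow> 'e \<Rightarrow> 'e \<Rightarrow> 'e" where
  "christoffel g p X Y = (THE W. \<forall>Z. g p W Z =
     (Der (\<lambda>q. g q Y Z) p X + Der (\<lambda>q. g q X Z) p Y - Der (\<lambda>q. g q X Y) p Z) / 2)"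

definition nabla :: "'e::euclidean_space metric \<Rightarrow> 'e \<Rightarrow> 'e \<Rightarrow> ('e \<Rightarrow> 'e) \<Rightarrow> 'e" where
  "nabla g p X Y = Der Y p X + christoffel g p X (Y p)"

text \<open>
  The curvature tensor \<open>R(X,Y)Z = \<nabla>\<^sub>X\<nabla>\<^sub>Y Z - \<nabla>\<^sub>Y\<nabla>\<^sub>X Z - \<nabla>\<^sub>[\<^sub>X\<^sub>,\<^sub>Y\<^sub>] Z\<close>; the tangent vectors are extended
  to constant coordinate fields, for which the bracket vanishes.
\<close>

definition curvature :: "'e::euclidean_space metric \<Rightarrow> 'e \<Rightarrow> 'e \<Rightarrow> 'e \<Rightarrow> 'e \<Rightarrow> 'e" where
  "curvature g p X Y Z =
     nabla g p X (\<lambda>q. nabla g q Y (\<lambda>_. Z)) - nabla g p Y (\<lambda>q. nabla g q X (\<lambda>_. Z))"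


section \<open>Manifolds and tensor fields\<close>

text \<open>A chart is a pair of its domain and a coordinate map, which is irrelevant off the domain.\<close>

type_synonym ('m, 'e) chart = "'m set \<times> ('m \<Rightarrow> 'e)"

definition transition :: "('m, 'e) chart \<Rightarrow> ('m, 'e) chart \<Rightarrow> 'e \<Rightarrow> 'e" where
  "transition a b = snd b \<circ> inv_into (fst a) (snd a)"

definition overlap :: "('m, 'e) chart \<Rightarrow> ('m, 'e) chart \<Rightarrow> 'e set" where
  "overlap a b = snd a ` (fst a \<inter> fst b)"

definition smooth_manifold :: "'m topology \<Rightarrow> ('m, 'e::euclidean_space) chart set \<Rightarrow> bool" where
  "smooth_manifold M A \<longleftrightarrow>
     Hausdorff_space M \<and> second_countable M \<and>
     (\<Union>a\<in>A. fst a) = topspace M \<and>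
     (\<forall>a\<in>A. openin M (fst a) \<and> open (snd a ` fst a) \<and>
        homeomorphic_map (subtopology M (fst a)) (top_of_set (snd a ` fst a)) (snd a)) \<and>
     (\<forall>a\<in>A. \<forall>b\<in>A. smooth_on (overlap a b) (transition a b))"

text \<open>
  A metric on a manifold is given by its representations \<open>g a\<close> in the charts \<open>a\<close>, subject to the
  tensor transformation law.
\<close>

definition pseudo_riemannian ::
    "'m topology \<Rightarrow> ('m, 'e::euclidean_space) chart set \<Rightarrow> (('m, 'e) chart \<Rightarrow> 'e metric) \<Rightarrow> bool" where
  "pseudo_riemannian M A g \<longleftrightarrow>
     smooth_manifold M A \<and>
     (\<forall>a\<in>A. metric_on (snd a ` fst a) (g a)) \<and>
     (\<forall>a\<in>A. \<forall>b\<in>A. \<forall>p\<in>overlap a b. \<forall>X Y.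
        g a p X Y = g b (transition a b p) (Der (transition a b) p X) (Der (transition a b) p Y))"


section \<open>Lorentzian complex space forms\<close>

text \<open>
  Manifolds of complex dimension 2 carry holomorphic charts with values in \<open>\<complex>\<^sup>2\<close>, in which the
  complex structure is multiplication by the imaginary unit.
\<close>

type_synonym 'm cchart = "('m, complex^2) chart"

definition J :: "complex^2 \<Rightarrow> complex^2" where
  "J X = \<i> *s X"

definition complex_surface :: "'m topology \<Rightarrow> 'm cchart set \<Rightarrow> bool" where
  "complex_surface M A \<longleftrightarrow>
     smooth_manifold M A \<and>
     (\<forall>a\<in>A. \<forall>b\<in>A. \<forall>p\<in>overlap a b. \<forall>X.
        Der (transition a b) p (J X) = J (Der (transition a b) p X))"

text \<open>
  A (pseudo-)Kaehler metric is a \<open>J\<close>-invariant metric with \<open>\<nabla>J = 0\<close>. Complex index 1 means that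
  maximal negative definite subspaces have real dimension 2.
\<close>

definition lorentzian_kaehler ::
    "'m topology \<Rightarrow> 'm cchart set \<Rightarrow> ('m cchart \<Rightarrow> (complex^2) metric) \<Rightarrow> bool" where
  "lorentzian_kaehler M A g \<longleftrightarrow>
     complex_surface M A \<and> pseudo_riemannian M A g \<and>
     (\<forall>a\<in>A. \<forall>p\<in>snd a ` fst a.
        (\<forall>X Y. g a p (J X) (J Y) = g a p X Y) \<and>
        (\<forall>X Y. smooth_on (snd a ` fst a) Y \<longrightarrow>
           nabla (g a) p X (\<lambda>q. J (Y q)) = J (nabla (g a) p X Y)) \<and>
        metric_index (g a p) = 2)"

definition lorentzian_complex_space_form ::
    "'m topology \<Rightarrow> 'm cchart set \<Rightarrow> ('m cchart \<Rightarrow> (complex^2) metric) \<Rightarrow> real \<Rightarrow> bool" where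
  "lorentzian_complex_space_form M A g c \<longleftrightarrow>
     lorentzian_kaehler M A g \<and>
     (\<forall>a\<in>A. \<forall>p\<in>snd a ` fst a. \<forall>X Y Z.
        curvature (g a) p X Y Z =
          c *\<^sub>R (g a p Y Z *\<^sub>R X - g a p X Z *\<^sub>R Y
               + g a p (J Y) Z *\<^sub>R J X - g a p (J X) Z *\<^sub>R J Y
               + (2 * g a p X (J Y)) *\<^sub>R J Z))"


section \<open>Parametrised surfaces in a coordinate domain\<close>

text \<open>
  Here \<open>F\<close> is the coordinate expression of an immersion of a surface, \<open>g\<close> the ambient metric
  in coordinates, and \<open>u\<close> a point of the parameter domain.
\<close>

definition induced_metric :: "(complex^2) metric \<Rightarrow> (real^2 \<Rightarrow> complex^2) \<Rightarrow> (real^2) metric" where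
  "induced_metric g F u X Y = g (F u) (Der F u X) (Der F u Y)"

definition tangent_space :: "(real^2 \<Rightarrow> complex^2) \<Rightarrow> real^2 \<Rightarrow> (complex^2) set" where
  "tangent_space F u = range (Der F u)"

definition normal_space ::
    "(complex^2) metric \<Rightarrow> (real^2 \<Rightarrow> complex^2) \<Rightarrow> real^2 \<Rightarrow> (complex^2) set" where
  "normal_space g F u = {\<xi>. \<forall>t\<in>tangent_space F u. g (F u) \<xi> t = 0}"

definition tangential ::
    "(complex^2) metric \<Rightarrow> (real^2 \<Rightarrow> complex^2) \<Rightarrow> real^2 \<Rightarrow> complex^2 \<Rightarrow> complex^2" where
  "tangential g F u v = (THE t. t \<in> tangent_space F u \<and> v - t \<in> normal_space g F u)"

text \<open>The ambient covariant derivative of a vector field \<open>V\<close> along \<open>F\<close> in direction \<open>X\<close>.\<close>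

definition nabla_along ::
    "(complex^2) metric \<Rightarrow> (real^2 \<Rightarrow> complex^2) \<Rightarrow> real^2 \<Rightarrow> real^2 \<Rightarrow> (real^2 \<Rightarrow> complex^2) \<Rightarrow> complex^2"
  where
  "nabla_along g F u X V = Der V u X + christoffel g (F u) (Der F u X) (V u)"

definition second_form ::
    "(complex^2) metric \<Rightarrow> (real^2 \<Rightarrow> complex^2) \<Rightarrow> real^2 \<Rightarrow> real^2 \<Rightarrow> real^2 \<Rightarrow> complex^2" where
  "second_form g F u X Y =
     (let D = nabla_along g F u X (\<lambda>w. Der F w Y) in D - tangential g F u D)"

text \<open>The trace of \<open>h\<close> with respect to the induced metric \<open>G\<close> is \<open>G\<^sup>i\<^sup>j h\<^sub>i\<^sub>j\<close>.\<close>

definition mean_curvature ::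
    "(complex^2) metric \<Rightarrow> (real^2 \<Rightarrow> complex^2) \<Rightarrow> real^2 \<Rightarrow> complex^2" where
  "mean_curvature g F u =
     (let G = (\<chi> i j. induced_metric g F u (axis i 1) (axis j 1)) :: real^2^2 in
      (1 / 2) *\<^sub>R (\<Sum>i\<in>UNIV. \<Sum>j\<in>UNIV.
         (matrix_inv G $ i $ j) *\<^sub>R second_form g F u (axis i 1) (axis j 1)))"

text \<open>Frame fields are given by their components in the parameter domain.\<close>

definition null_frame_on ::
    "(complex^2) metric \<Rightarrow> (real^2 \<Rightarrow> complex^2) \<Rightarrow> (real^2) set \<Rightarrow>
     (real^2 \<Rightarrow> real^2) \<Rightarrow> (real^2 \<Rightarrow> real^2) \<Rightarrow> bool" where
  "null_frame_on g F S e1 e2 \<longleftrightarrow> smooth_on S e1 \<and> smooth_on S e2 \<and>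
     (\<forall>u\<in>S. induced_metric g F u (e1 u) (e1 u) = 0 \<and>
            induced_metric g F u (e2 u) (e2 u) = 0 \<and>
            induced_metric g F u (e1 u) (e2 u) = - 1)"

text \<open>The tangential component \<open>P X\<close> of \<open>J X\<close>, for a tangent vector with components \<open>X\<close>.\<close>

definition P ::
    "(complex^2) metric \<Rightarrow> (real^2 \<Rightarrow> complex^2) \<Rightarrow> real^2 \<Rightarrow> real^2 \<Rightarrow> complex^2" where
  "P g F u X = tangential g F u (J (Der F u X))"

definition wirtinger_angle_on ::
    "(complex^2) metric \<Rightarrow> (real^2 \<Rightarrow> complex^2) \<Rightarrow> (real^2) set \<Rightarrow>
     (real^2 \<Rightarrow> real^2) \<Rightarrow> (real^2 \<Rightarrow> real^2) \<Rightarrow> (real^2 \<Rightarrow> real) \<Rightarrow> bool" where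
  "wirtinger_angle_on g F S e1 e2 \<alpha> \<longleftrightarrow>
     (\<forall>u\<in>S. P g F u (e1 u) = sinh (\<alpha> u) *\<^sub>R Der F u (e1 u) \<and>
            P g F u (e2 u) = - (sinh (\<alpha> u) *\<^sub>R Der F u (e2 u)))"


section \<open>Surfaces in a complex surface\<close>

type_synonym 'n schart = "('n, real^2) chart"

definition local_dom :: "'m cchart \<Rightarrow> 'n schart \<Rightarrow> ('n \<Rightarrow> 'm) \<Rightarrow> (real^2) set" where
  "local_dom a b f = snd b ` (fst b \<inter> f -` fst a)"

definition local_rep :: "'m cchart \<Rightarrow> 'n schart \<Rightarrow> ('n \<Rightarrow> 'm) \<Rightarrow> real^2 \<Rightarrow> complex^2" where
  "local_rep a b f = snd a \<circ> f \<circ> inv_into (fst b) (snd b)"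

definition immersed_surface ::
    "'m topology \<Rightarrow> 'm cchart set \<Rightarrow> 'n topology \<Rightarrow> 'n schart set \<Rightarrow> ('n \<Rightarrow> 'm) \<Rightarrow> bool" where
  "immersed_surface M A N B f \<longleftrightarrow>
     smooth_manifold N B \<and> continuous_map N M f \<and>
     (\<forall>a\<in>A. \<forall>b\<in>B. smooth_on (local_dom a b f) (local_rep a b f) \<and>
        (\<forall>u\<in>local_dom a b f. inj (Der (local_rep a b f) u)))"

definition lorentzian_surface ::
    "'m topology \<Rightarrow> 'm cchart set \<Rightarrow> ('m cchart \<Rightarrow> (complex^2) metric) \<Rightarrow>
     'n topology \<Rightarrow> 'n schart set \<Rightarrow> ('n \<Rightarrow> 'm) \<Rightarrow> bool" where
  "lorentzian_surface M A g N B f \<longleftrightarrow>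
     immersed_surface M A N B f \<and>
     (\<forall>a\<in>A. \<forall>b\<in>B. \<forall>u\<in>local_dom a b f.
        scalar_product (induced_metric (g a) (local_rep a b f) u) \<and>
        metric_index (induced_metric (g a) (local_rep a b f) u) = 1)"

definition minimal_surface ::
    "'m cchart set \<Rightarrow> ('m cchart \<Rightarrow> (complex^2) metric) \<Rightarrow> 'n schart set \<Rightarrow> ('n \<Rightarrow> 'm) \<Rightarrow> bool" where
  "minimal_surface A g B f \<longleftrightarrow>
     (\<forall>a\<in>A. \<forall>b\<in>B. \<forall>u\<in>local_dom a b f. mean_curvature (g a) (local_rep a b f) u = 0)"

definition flat_surface ::
    "'m cchart set \<Rightarrow> ('m cchart \<Rightarrow> (complex^2) metric) \<Rightarrow> 'n schart set \<Rightarrow> ('n \<Rightarrow> 'm) \<Rightarrow> bool" where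
  "flat_surface A g B f \<longleftrightarrow>
     (\<forall>a\<in>A. \<forall>b\<in>B. \<forall>u\<in>local_dom a b f. \<forall>X Y Z.
        curvature (induced_metric (g a) (local_rep a b f)) u X Y Z = 0)"

text \<open>
  Interchanging \<open>e1\<close> and \<open>e2\<close> changes the sign of the Wirtinger angle, so it is constant for suitable
  local null frames around every point.
\<close>

definition slant_surface ::
    "'m cchart set \<Rightarrow> ('m cchart \<Rightarrow> (complex^2) metric) \<Rightarrow>
     'n topology \<Rightarrow> 'n schart set \<Rightarrow> ('n \<Rightarrow> 'm) \<Rightarrow> bool" where
  "slant_surface A g N B f \<longleftrightarrow>
     (\<exists>\<alpha>\<^sub>0. \<forall>x\<in>topspace N. \<exists>a\<in>A. \<exists>b\<in>B. \<exists>S e1 e2.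
        x \<in> fst b \<and> f x \<in> fst a \<and> open S \<and> snd b x \<in> S \<and> S \<subseteq> local_dom a b f \<and>
        null_frame_on (g a) (local_rep a b f) S e1 e2 \<and>
        wirtinger_angle_on (g a) (local_rep a b f) S e1 e2 (\<lambda>_. \<alpha>\<^sub>0))"

text \<open>A surface is Lagrangian if \<open>J\<close> maps its tangent spaces onto its normal spaces.\<close>

definition lagrangian_surface ::
    "'m cchart set \<Rightarrow> ('m cchart \<Rightarrow> (complex^2) metric) \<Rightarrow> 'n schart set \<Rightarrow> ('n \<Rightarrow> 'm) \<Rightarrow> bool" where
  "lagrangian_surface A g B f \<longleftrightarrow>
     (\<forall>a\<in>A. \<forall>b\<in>B. \<forall>u\<in>local_dom a b f.
        J ` tangent_space (local_rep a b f) u = normal_space (g a) (local_rep a b f) u)"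

end

theory Submission
  imports Defs
begin

text \<open>
  The reason is the Codazzi equation. Let \<open>E1\<close>, \<open>E2\<close> be a null frame of the surface with
  \<open>\<langle>E1, E2\<rangle> = -1\<close>, let \<open>\<nabla>\<close> be the ambient connection along the surface, and put \<open>s = sinh \<alpha>\<close>, so that
  \<open>\<langle>J E1, E2\<rangle> = - s\<close> is constant. The vectors \<open>n1 = J E1 - s E1\<close> and \<open>n2 = J E2 + s E2\<close> are null and
  span the normal plane, with \<open>\<langle>n1, n2\<rangle> = - (1 + s\<^sup>2)\<close>.

  Minimality says \<open>h(E1, E2) = 0\<close>; as the frame is null, it follows that \<open>\<nabla>\<close> of \<open>E1\<close> along \<open>e2\<close> is a multiple of
  \<open>E1\<close>, and \<open>\<nabla>\<close> of \<open>E2\<close> along \<open>e1\<close> a multiple of \<open>E2\<close>. Differentiating the constants \<open>\<langle>E1, E2\<rangle>\<close> and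
  \<open>\<langle>J E1, E2\<rangle>\<close>, where \<open>\<nabla> J = 0\<close>, one finds that the normal part of \<open>\<nabla>\<close> of \<open>E1\<close> along \<open>e1\<close> is a multiple of
  \<open>n2\<close>, and that of \<open>\<nabla>\<close> of \<open>E2\<close> along \<open>e2\<close> a multiple of \<open>n1\<close>. In particular \<open>\<langle>\<nabla>\<^sub>X E1, n2\<rangle> = 0\<close> for every
  direction \<open>X\<close> at every point. This may be differentiated again: for constant coordinate fields
  \<open>X\<close>, \<open>Y\<close> it gives \<open>\<langle>\<nabla>\<^sub>X \<nabla>\<^sub>Y E1, n2\<rangle> = - \<langle>\<nabla>\<^sub>Y E1, \<nabla>\<^sub>X n2\<rangle>\<close>. Antisymmetrising in directions which agree
  with \<open>e1\<close> and \<open>e2\<close> at one point turns the left hand side into \<open>\<langle>R(E1, E2) E1, n2\<rangle>\<close>, while the right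
  hand side vanishes by the multiples just found (\<open>codazzi_term_vanishes\<close>). The curvature formula of
  a complex space form evaluates the same expression to \<open>- 3 c s (1 + s\<^sup>2)\<close>
  (\<open>curvature_term\<close>), and so \<open>s = 0\<close> when \<open>c \<noteq> 0\<close>.
  This is \<open>minimal_slant_imp_sinh_angle_0\<close>.

  The calculus needed for it is that of the Levi-Civita connection in coordinates. The Christoffel
  symbols are defined as the solution of a linear system, so that their differentiability has to be
  proved (\<open>differentiable_solution\<close>); with it, and with the symmetry of second derivatives,
  \<open>nabla_along_commute\<close> expresses the curvature by commuting covariant derivatives along the surface.

  Slantness provides a frame only in some pair of charts around each point. The vanishing of the
  pulled back Kaehler form \<open>\<langle>J X, Y\<rangle>\<close>, which \<open>s = 0\<close> amounts to, is carried to all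
  other charts by \<open>Der_local_rep_change\<close>, and it is equivalent there to being Lagrangian by
  a dimension count (\<open>lagrangian_plane\<close>).
\<close>

section \<open>Calculus of maps of finite differentiability class\<close>

lemma has_derivative_Der:
  "f differentiable (at p) \<Longrightarrow> (f has_derivative Der f p) (at p)"
  by (simp add: frechet_derivative_works)

lemma Der_eqI: "(f has_derivative f') (at p) \<Longrightarrow> Der f p v = f' v"
  using frechet_derivative_at by metis

lemma linear_Der: "f differentiable (at p) \<Longrightarrow> linear (Der f p)"
  by (rule linear_frechet_derivative)

lemma Der_cong_open:
  assumes "open S" "p \<in> S" "\<And>q. q \<in> S \<Longrightarrow> f q = h q" "f differentiable (at p)"
  shows "Der f p = Der h p"
  by (metis assms frechet_derivative_transform_within_open)

lemma differentiable_cong_open: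
  assumes "open S" "p \<in> S" "\<And>q. q \<in> S \<Longrightarrow> f q = h q" "f differentiable (at p)"
  shows "h differentiable (at p)"
  using assms has_derivative_transform_within_open unfolding differentiable_def by metis

lemma Ck_on_cong:
  assumes "open S" "\<And>q. q \<in> S \<Longrightarrow> f q = h q" "Ck_on k S f"
  shows "Ck_on k S h"
  using assms
proof (induction k arbitrary: f h)
  case 0
  then show ?case by (metis Ck_on.simps(1) continuous_on_eq)
next
  case (Suc k)
  have "h differentiable (at p)" if "p \<in> S" for p
    using Suc.prems that differentiable_cong_open by (metis Ck_on.simps(2))
  moreover have "Ck_on k S (\<lambda>p. Der h p v)" for v
  proof (rule Suc.IH)
    show "Der f q v = Der h q v" if "q \<in> S" for q
      using Der_cong_open[of S q f h] Suc.prems that by auto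
  qed (use Suc.prems in auto)
  ultimately show ?case by simp
qed

lemma Ck_on_subset: "Ck_on k S f \<Longrightarrow> T \<subseteq> S \<Longrightarrow> Ck_on k T f"
  by (induction k arbitrary: f) (auto intro: continuous_on_subset)

lemma Ck_on_lower: "Ck_on (Suc k) S f \<Longrightarrow> Ck_on k S f"
  by (induction k arbitrary: f)
    (auto intro!: continuous_at_imp_continuous_on differentiable_imp_continuous_within)

lemma Ck_on_const: "Ck_on k S (\<lambda>_. c)"
  by (induction k arbitrary: c) auto

lemma Ck_on_add:
  assumes "open S" "Ck_on k S f" "Ck_on k S h"
  shows "Ck_on k S (\<lambda>p. f p + h p)"
  using assms(2,3)
proof (induction k arbitrary: f h)
  case 0
  then show ?case by (simp add: continuous_on_add)
next
  case (Suc k)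
  have "Ck_on k S (\<lambda>p. Der (\<lambda>p. f p + h p) p v)" for v
  proof (rule Ck_on_cong[OF assms(1)])
    show "Ck_on k S (\<lambda>p. Der f p v + Der h p v)"
      using Suc by auto
    show "Der f p v + Der h p v = Der (\<lambda>p. f p + h p) p v" if "p \<in> S" for p
      using Suc.prems that
      by (intro Der_eqI[symmetric] has_derivative_add has_derivative_Der) auto
  qed
  with Suc.prems show ?case by auto
qed

lemma Ck_on_scaleR:
  assumes "open S" "Ck_on k S f" "Ck_on k S h"
  shows "Ck_on k S (\<lambda>p. f p *\<^sub>R h p)"
  using assms(2,3)
proof (induction k arbitrary: f h)
  case 0
  then show ?case by (simp add: continuous_on_scaleR)
next
  case (Suc k)
  have "Ck_on k S (\<lambda>p. Der (\<lambda>p. f p *\<^sub>R h p) p v)" for v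
  proof (rule Ck_on_cong[OF assms(1)])
    show "Ck_on k S (\<lambda>p. f p *\<^sub>R Der h p v + Der f p v *\<^sub>R h p)"
      using Suc.prems by (intro Ck_on_add[OF assms(1)] Suc.IH) (auto intro: Ck_on_lower)
    show "f p *\<^sub>R Der h p v + Der f p v *\<^sub>R h p = Der (\<lambda>p. f p *\<^sub>R h p) p v" if "p \<in> S" for p
      using Suc.prems that
      by (intro Der_eqI[symmetric] has_derivative_scaleR has_derivative_Der) auto
  qed
  with Suc.prems show ?case by auto
qed

lemma Ck_on_sum:
  assumes "open S" "finite I" "\<And>i. i \<in> I \<Longrightarrow> Ck_on k S (f i)"
  shows "Ck_on k S (\<lambda>p. \<Sum>i\<in>I. f i p)"
  using assms(2,3) by (induction I) (auto intro: Ck_on_const Ck_on_add[OF assms(1)])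

lemma Ck_on_bounded_linear:
  assumes "open S" "bounded_linear L" "Ck_on k S f"
  shows "Ck_on k S (\<lambda>p. L (f p))"
  using assms(3)
proof (induction k arbitrary: f)
  case 0
  then show ?case by (simp add: bounded_linear.continuous_on[OF assms(2)])
next
  case (Suc k)
  have der: "((\<lambda>p. L (f p)) has_derivative (\<lambda>v. L (Der f p v))) (at p)" if "p \<in> S" for p
    using Suc.prems that
    by (intro bounded_linear.has_derivative[OF assms(2)] has_derivative_Der) auto
  have "Ck_on k S (\<lambda>p. Der (\<lambda>p. L (f p)) p v)" for v
  proof (rule Ck_on_cong[OF assms(1)])
    show "Ck_on k S (\<lambda>p. L (Der f p v))"
      using Suc by auto
    show "L (Der f p v) = Der (\<lambda>p. L (f p)) p v" if "p \<in> S" for p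
      using Der_eqI[OF der[OF that]] by simp
  qed
  moreover have "(\<lambda>p. L (f p)) differentiable (at p)" if "p \<in> S" for p
    using der[OF that] differentiableI by blast
  ultimately show ?case by auto
qed

lemma Der_scaleR: "f differentiable (at q) \<Longrightarrow> Der f q (c *\<^sub>R v) = c *\<^sub>R Der f q v"
  using linear_Der[of f q] by (simp add: linear_cmul)

lemma DERIV_along_line:
  fixes f :: "'a::real_normed_vector \<Rightarrow> 'b::euclidean_space"
  assumes "f differentiable (at (p + r *\<^sub>R x))"
  shows "((\<lambda>r. f (p + r *\<^sub>R x) \<bullet> b) has_real_derivative Der f (p + r *\<^sub>R x) x \<bullet> b) (at r)"
proof -
  have "((\<lambda>r. p + r *\<^sub>R x) has_derivative (\<lambda>h. h *\<^sub>R x)) (at r)"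
    by (auto intro!: derivative_eq_intros)
  from has_derivative_compose[OF this has_derivative_Der[OF assms]]
  have "((\<lambda>r. f (p + r *\<^sub>R x)) has_derivative (\<lambda>h. h *\<^sub>R Der f (p + r *\<^sub>R x) x)) (at r)"
    by (simp add: Der_scaleR[OF assms])
  from has_derivative_inner_left[OF this, of b]
  show ?thesis
    by (simp add: has_field_derivative_def mult_commute_abs)
qed

text \<open>
  Two applications of the mean value theorem, first along \<open>x\<close> and then along \<open>y\<close>. The scalar product
  with \<open>b\<close> is there because the mean value theorem fails for vector valued maps.
\<close>

lemma second_difference_mean_value:
  fixes f :: "'a::euclidean_space \<Rightarrow> 'b::euclidean_space"
  assumes C2: "Ck_on 2 S f" and t: "t > 0"
    and sub: "\<And>r s. 0 \<le> r \<Longrightarrow> r \<le> t \<Longrightarrow> 0 \<le> s \<Longrightarrow> s \<le> t \<Longrightarrow> p + r *\<^sub>R x + s *\<^sub>R y \<in> S"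
  shows "\<exists>r s. 0 < r \<and> r < t \<and> 0 < s \<and> s < t \<and>
    (f (p + t *\<^sub>R x + t *\<^sub>R y) - f (p + t *\<^sub>R x) - f (p + t *\<^sub>R y) + f p) \<bullet> b =
       t * (t * (Der (\<lambda>q. Der f q x) (p + r *\<^sub>R x + s *\<^sub>R y) y \<bullet> b))"
proof -
  have d1: "f differentiable (at q)" and d2: "(\<lambda>q. Der f q x) differentiable (at q)" if "q \<in> S" for q
    using C2 that by (auto simp: numeral_2_eq_2)
  define \<phi> where "\<phi> r = f ((p + t *\<^sub>R y) + r *\<^sub>R x) \<bullet> b - f (p + r *\<^sub>R x) \<bullet> b" for r
  have "\<exists>r. 0 < r \<and> r < t \<and> \<phi> t - \<phi> 0 =
    (t - 0) * (Der f ((p + t *\<^sub>R y) + r *\<^sub>R x) x \<bullet> b - Der f (p + r *\<^sub>R x) x \<bullet> b)"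
    unfolding \<phi>_def
  proof (rule MVT2[OF t], rule DERIV_diff)
    fix r assume r: "0 \<le> r" "r \<le> t"
    have "(p + t *\<^sub>R y) + r *\<^sub>R x \<in> S" "p + r *\<^sub>R x \<in> S"
      using sub[of r t] sub[of r 0] r t by (auto simp: algebra_simps)
    from this[THEN d1, THEN DERIV_along_line]
    show "((\<lambda>r. f ((p + t *\<^sub>R y) + r *\<^sub>R x) \<bullet> b) has_real_derivative Der f ((p + t *\<^sub>R y) + r *\<^sub>R x) x \<bullet> b) (at r)"
      "((\<lambda>r. f (p + r *\<^sub>R x) \<bullet> b) has_real_derivative Der f (p + r *\<^sub>R x) x \<bullet> b) (at r)" .
  qed
  then obtain r where r: "0 < r" "r < t" and
    \<phi>: "\<phi> t - \<phi> 0 = t * (Der f (p + r *\<^sub>R x + t *\<^sub>R y) x \<bullet> b - Der f (p + r *\<^sub>R x) x \<bullet> b)"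
    by (auto simp: algebra_simps)
  have "\<exists>s. 0 < s \<and> s < t \<and>
    Der f (p + r *\<^sub>R x + t *\<^sub>R y) x \<bullet> b - Der f (p + r *\<^sub>R x + 0 *\<^sub>R y) x \<bullet> b =
    (t - 0) * (Der (\<lambda>q. Der f q x) (p + r *\<^sub>R x + s *\<^sub>R y) y \<bullet> b)"
    using r sub by (intro MVT2[OF t] DERIV_along_line d2) auto
  then obtain s where s: "0 < s" "s < t" and
    \<psi>: "Der f (p + r *\<^sub>R x + t *\<^sub>R y) x \<bullet> b - Der f (p + r *\<^sub>R x) x \<bullet> b =
      t * (Der (\<lambda>q. Der f q x) (p + r *\<^sub>R x + s *\<^sub>R y) y \<bullet> b)"
    by auto
  have "\<phi> t - \<phi> 0 = (f (p + t *\<^sub>R x + t *\<^sub>R y) - f (p + t *\<^sub>R x) - f (p + t *\<^sub>R y) + f p) \<bullet> b"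
    by (simp add: \<phi>_def algebra_simps inner_diff_left inner_add_left)
  with \<phi> \<psi> r s show ?thesis by metis
qed

text \<open>
  The second difference of \<open>f\<close> does not change when \<open>x\<close> and \<open>y\<close> are interchanged, and by
  \<open>second_difference_mean_value\<close> it approximates both mixed derivatives, which are continuous.
\<close>

proposition second_derivative_symmetric:
  fixes f :: "'a::euclidean_space \<Rightarrow> 'b::euclidean_space"
  assumes S: "open S" "p \<in> S" and C2: "Ck_on 2 S f"
  shows "Der (\<lambda>q. Der f q x) p y = Der (\<lambda>q. Der f q y) p x"
proof (rule euclidean_eqI)
  fix b :: 'b
  let ?D = "\<lambda>x y q. Der (\<lambda>q. Der f q x) q y \<bullet> b"
  have cont: "isCont (?D x y) p" for x y
    using C2 S by (auto simp: numeral_2_eq_2 continuous_on_eq_continuous_at intro!: continuous_intros)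
  have le: "\<bar>?D x y p - ?D y x p\<bar> \<le> e + e" if e: "e > 0" for e
  proof -
    obtain d0 where d0: "d0 > 0" "ball p d0 \<subseteq> S"
      using S open_contains_ball by blast
    have "\<exists>d>0. \<forall>q. dist q p < d \<longrightarrow> dist (?D x y q) (?D x y p) < e" for x y
      using cont[of x y] e unfolding continuous_at_eps_delta by blast
    then obtain d1 d2 where d1: "d1 > 0" "\<And>q. dist q p < d1 \<Longrightarrow> dist (?D x y q) (?D x y p) < e"
      and d2: "d2 > 0" "\<And>q. dist q p < d2 \<Longrightarrow> dist (?D y x q) (?D y x p) < e"
      by metis
    define d where "d = min d0 (min d1 d2)"
    define t where "t = d / (norm x + norm y + 1)"
    have d: "d > 0" "d \<le> d0" "d \<le> d1" "d \<le> d2" using d0 d1 d2 by (auto simp: d_def)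
    have n: "norm x + norm y + 1 > 0" by (simp add: add_nonneg_pos)
    have t: "t > 0" using d n by (simp add: t_def)
    have "t * (norm x + norm y) < t * (norm x + norm y + 1)" using t by simp
    also have "\<dots> = d" using n by (simp add: t_def)
    finally have td: "t * (norm x + norm y) < d" .
    \<comment> \<open>the choice of \<open>t\<close> keeps the whole parallelogram within distance \<open>d\<close> of \<open>p\<close>\<close>
    have near: "dist (p + r *\<^sub>R x + s *\<^sub>R y) p < d" if "0 \<le> r" "r \<le> t" "0 \<le> s" "s \<le> t" for r s
    proof -
      have "dist (p + r *\<^sub>R x + s *\<^sub>R y) p \<le> norm (r *\<^sub>R x) + norm (s *\<^sub>R y)"
        by (simp add: dist_norm add.assoc norm_triangle_ineq del: norm_scaleR)
      also have "\<dots> \<le> t * norm x + t * norm y"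
        using that by (intro add_mono) (auto intro: mult_right_mono)
      finally show ?thesis using td by (simp add: algebra_simps)
    qed
    then have sub: "p + r *\<^sub>R x + s *\<^sub>R y \<in> S" if "0 \<le> r" "r \<le> t" "0 \<le> s" "s \<le> t" for r s
      using that d d0 by (force simp: subset_iff dist_commute)
    obtain r s where rs: "0 < r" "r < t" "0 < s" "s < t"
      "(f (p + t *\<^sub>R x + t *\<^sub>R y) - f (p + t *\<^sub>R x) - f (p + t *\<^sub>R y) + f p) \<bullet> b =
       t * (t * ?D x y (p + r *\<^sub>R x + s *\<^sub>R y))"
      using second_difference_mean_value[OF C2 t, of p x y b] sub by auto
    have sub': "p + r *\<^sub>R y + s *\<^sub>R x \<in> S" if "0 \<le> r" "r \<le> t" "0 \<le> s" "s \<le> t" for r s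
      using sub[of s r] that by (simp add: algebra_simps)
    obtain r' s' where rs': "0 < r'" "r' < t" "0 < s'" "s' < t"
      "(f (p + t *\<^sub>R y + t *\<^sub>R x) - f (p + t *\<^sub>R y) - f (p + t *\<^sub>R x) + f p) \<bullet> b =
       t * (t * ?D y x (p + r' *\<^sub>R y + s' *\<^sub>R x))"
      using second_difference_mean_value[OF C2 t, of p y x b] sub' by auto
    have "t * (t * ?D x y (p + r *\<^sub>R x + s *\<^sub>R y)) = t * (t * ?D y x (p + s' *\<^sub>R x + r' *\<^sub>R y))"
      using rs(5) rs'(5) by (simp add: algebra_simps)
    then have "?D x y (p + r *\<^sub>R x + s *\<^sub>R y) = ?D y x (p + s' *\<^sub>R x + r' *\<^sub>R y)"
      using t by simp
    moreover have "dist (?D x y (p + r *\<^sub>R x + s *\<^sub>R y)) (?D x y p) < e"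
      using near[of r s] rs d by (intro d1) auto
    moreover have "dist (?D y x (p + s' *\<^sub>R x + r' *\<^sub>R y)) (?D y x p) < e"
      using near[of s' r'] rs' d by (intro d2) auto
    ultimately show ?thesis by (simp add: dist_real_def)
  qed
  have "\<bar>?D x y p - ?D y x p\<bar> \<le> 0"
  proof (rule field_le_epsilon)
    fix e :: real assume "0 < e"
    then show "\<bar>?D x y p - ?D y x p\<bar> \<le> 0 + e" using le[of "e / 2"] by simp
  qed
  then show "?D x y p = ?D y x p" by simp
qed

section \<open>Families of linear and bilinear maps\<close>

lemma linear_expand_Basis:
  fixes f :: "'e::euclidean_space \<Rightarrow> 'b::real_vector"
  assumes "linear f"
  shows "f X = (\<Sum>i\<in>Basis. (X \<bullet> i) *\<^sub>R f i)"
proof -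
  have "f X = f (\<Sum>i\<in>Basis. (X \<bullet> i) *\<^sub>R i)"
    by (simp add: euclidean_representation)
  also have "\<dots> = (\<Sum>i\<in>Basis. (X \<bullet> i) *\<^sub>R f i)"
    by (simp add: linear_sum[OF assms] linear_cmul[OF assms])
  finally show ?thesis .
qed

text \<open>
  A product rule for evaluating a variable linear map at a variable vector. In a basis it is the
  product rule for the coefficients, so it suffices to know the derivative at each fixed vector.
\<close>

lemma has_derivative_linear_family:
  fixes L :: "'p::real_normed_vector \<Rightarrow> 'e::euclidean_space \<Rightarrow> 'b::real_normed_vector"
  assumes U: "open U" "u \<in> U" and lin: "\<And>w. w \<in> U \<Longrightarrow> linear (L w)"
    and L: "\<And>X. ((\<lambda>w. L w X) has_derivative D X) (at u)"
    and x: "(x has_derivative x') (at u)"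
  shows "((\<lambda>w. L w (x w)) has_derivative (\<lambda>h. D (x u) h + L u (x' h))) (at u)"
proof -
  have expand: "L w X = (\<Sum>b\<in>Basis. (X \<bullet> b) *\<^sub>R L w b)" if "w \<in> U" for w X
    using lin[OF that] by (rule linear_expand_Basis)
  have D: "D X h = (\<Sum>b\<in>Basis. (X \<bullet> b) *\<^sub>R D b h)" for X h
  proof -
    have "((\<lambda>w. \<Sum>b\<in>Basis. (X \<bullet> b) *\<^sub>R L w b) has_derivative (\<lambda>h. \<Sum>b\<in>Basis. (X \<bullet> b) *\<^sub>R D b h)) (at u)"
      by (intro has_derivative_sum has_derivative_scaleR_right L)
    then have "((\<lambda>w. L w X) has_derivative (\<lambda>h. \<Sum>b\<in>Basis. (X \<bullet> b) *\<^sub>R D b h)) (at u)"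
      by (rule has_derivative_transform_within_open[OF _ U]) (simp add: expand[symmetric])
    from has_derivative_unique[OF L this] show ?thesis by metis
  qed
  have "((\<lambda>w. \<Sum>b\<in>Basis. (x w \<bullet> b) *\<^sub>R L w b) has_derivative
      (\<lambda>h. \<Sum>b\<in>Basis. (x u \<bullet> b) *\<^sub>R D b h + (x' h \<bullet> b) *\<^sub>R L u b)) (at u)"
    by (intro has_derivative_sum has_derivative_scaleR L has_derivative_inner_left x)
  then have "((\<lambda>w. L w (x w)) has_derivative
      (\<lambda>h. \<Sum>b\<in>Basis. (x u \<bullet> b) *\<^sub>R D b h + (x' h \<bullet> b) *\<^sub>R L u b)) (at u)"
    by (rule has_derivative_transform_within_open[OF _ U]) (simp add: expand[symmetric])
  moreover have "(\<Sum>b\<in>Basis. (x u \<bullet> b) *\<^sub>R D b h + (x' h \<bullet> b) *\<^sub>R L u b) = D (x u) h + L u (x' h)" for h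
    by (simp only: sum.distrib D[of "x u"] expand[OF U(2), of "x' h"])
  ultimately show ?thesis by simp
qed

text \<open>
  This is the form in which metrics and Christoffel symbols are differentiated along a map \<open>F\<close>.
\<close>

lemma has_derivative_bilinear_family_along:
  fixes B :: "'p::real_normed_vector \<Rightarrow> 'e::euclidean_space \<Rightarrow> 'f::euclidean_space \<Rightarrow> 'b::real_normed_vector"
    and F :: "'d::real_normed_vector \<Rightarrow> 'p"
  assumes S: "open S" "u \<in> S" and bil: "\<And>w. w \<in> S \<Longrightarrow> bilinear (B (F w))"
    and B: "\<And>X Y. (\<lambda>q. B q X Y) differentiable (at (F u))"
    and F: "(F has_derivative F') (at u)"
    and x: "(x has_derivative x') (at u)" and y: "(y has_derivative y') (at u)"
  shows "((\<lambda>w. B (F w) (x w) (y w)) has_derivative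
    (\<lambda>h. Der (\<lambda>q. B q (x u) (y u)) (F u) (F' h) + B (F u) (x' h) (y u) + B (F u) (x u) (y' h))) (at u)"
proof (rule has_derivative_linear_family[OF S _ _ y])
  show "linear (B (F w) (x w))" if "w \<in> S" for w
    using bil[OF that] by (simp add: bilinear_def)
  show "((\<lambda>w. B (F w) (x w) Y) has_derivative
      (\<lambda>h. Der (\<lambda>q. B q (x u) Y) (F u) (F' h) + B (F u) (x' h) Y)) (at u)" for Y
  proof (rule has_derivative_linear_family[OF S _ _ x])
    show "linear (\<lambda>X. B (F w) X Y)" if "w \<in> S" for w
      using bil[OF that] by (simp add: bilinear_def)
    show "((\<lambda>w. B (F w) X Y) has_derivative (\<lambda>h. Der (\<lambda>q. B q X Y) (F u) (F' h))) (at u)" for X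
      by (rule has_derivative_compose[OF F has_derivative_Der[OF B]])
  qed
qed

text \<open>
  A product rule in which the factor \<open>h\<close> need only be continuous, since the other factor vanishes at
  the point in question.
\<close>

lemma has_derivative_scaleR_vanishing:
  fixes f :: "'a::real_normed_vector \<Rightarrow> 'b::real_normed_vector" and h :: "'a \<Rightarrow> real"
  assumes f: "(f has_derivative f') (at p)" and f0: "f p = 0" and h: "isCont h p"
  shows "((\<lambda>q. h q *\<^sub>R f q) has_derivative (\<lambda>v. h p *\<^sub>R f' v)) (at p)"
proof -
  interpret f': bounded_linear f' using f by (rule has_derivative_bounded_linear)
  obtain K where K: "\<And>v. norm (f' v) \<le> norm v * K" using f'.bounded by blast
  let ?r = "\<lambda>q. (f q - f' (q - p)) /\<^sub>R norm (q - p)"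
  let ?l = "\<lambda>q. f' (q - p) /\<^sub>R norm (q - p)"
  have r: "(?r \<longlongrightarrow> 0) (at p)"
    using f f0 by (simp add: has_derivative_at_within)
  have h0: "((\<lambda>q. h q - h p) \<longlongrightarrow> 0) (at p)"
    using h by (simp add: LIM_zero isCont_def)
  have l: "Bfun ?l (at p)"
  proof (rule BfunI)
    show "\<forall>\<^sub>F q in at p. norm (?l q) \<le> K"
      unfolding eventually_at_filter
      by (intro always_eventually allI impI) (use K in \<open>auto simp: field_simps\<close>)
  qed
  have "((\<lambda>q. (h q - h p) *\<^sub>R ?l q) \<longlongrightarrow> 0) (at p)"
  proof -
    have "Zfun (\<lambda>q. (h q - h p) *\<^sub>R ?l q) (at p)"
      using h0 by (intro bounded_bilinear.Zfun_prod_Bfun[OF bounded_bilinear_scaleR _ l])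
        (simp add: tendsto_Zfun_iff)
    then show ?thesis by (simp add: tendsto_Zfun_iff)
  qed
  moreover have "((\<lambda>q. h q *\<^sub>R ?r q) \<longlongrightarrow> h p *\<^sub>R 0) (at p)"
    using h r by (intro tendsto_scaleR) (simp_all add: isCont_def)
  ultimately have "((\<lambda>q. h q *\<^sub>R ?r q + (h q - h p) *\<^sub>R ?l q) \<longlongrightarrow> 0) (at p)"
    by (auto intro: tendsto_add_zero)
  moreover have "h q *\<^sub>R ?r q + (h q - h p) *\<^sub>R ?l q =
      (h q *\<^sub>R f q - h p *\<^sub>R f p - h p *\<^sub>R f' (q - p)) /\<^sub>R norm (q - p)" for q
    by (simp add: f0 algebra_simps)
  ultimately show ?thesis
    by (simp add: has_derivative_at_within f'.bounded_linear_axioms bounded_linear_scaleR_right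
        bounded_linear_const_scaleR)
qed

section \<open>Nondegenerate scalar products\<close>

lemma scalar_productD:
  assumes "scalar_product b"
  shows "bilinear b" "b X Y = b Y X" "(\<And>Y. b X Y = 0) \<Longrightarrow> X = 0"
  using assms unfolding scalar_product_def by blast+

lemma scalar_product_eqI:
  assumes "scalar_product b" "\<And>Z. b X Z = b Y Z"
  shows "X = Y"
  using scalar_productD(3)[OF assms(1), of "X - Y"] assms(2)
  by (simp add: bilinear_lsub[OF scalar_productD(1)[OF assms(1)]])

text \<open>
  Index lowering: the vector that represents the functional \<open>b X\<close> by the Euclidean inner product.
\<close>

definition lower :: "('e::euclidean_space \<Rightarrow> 'e \<Rightarrow> real) \<Rightarrow> 'e \<Rightarrow> 'e" where
  "lower b X = (\<Sum>i\<in>Basis. b X i *\<^sub>R i)"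

lemma inner_lower:
  assumes "bilinear b"
  shows "lower b X \<bullet> Z = b X Z"
  using linear_expand_Basis[of "b X" Z] assms
  by (simp add: bilinear_def lower_def inner_sum_right inner_commute[of _ Z] mult.commute)

lemma linear_lower:
  assumes "bilinear b"
  shows "linear (lower b)"
  unfolding lower_def
  by (rule linearI) (simp_all add: bilinear_ladd[OF assms] bilinear_lmul[OF assms]
      scaleR_left_distrib sum.distrib scaleR_sum_right)

lemma inj_lower:
  assumes "scalar_product b"
  shows "inj (lower b)"
proof (rule injI)
  fix X Y assume "lower b X = lower b Y"
  then show "X = Y"
    by (intro scalar_product_eqI[OF assms]) (metis inner_lower scalar_productD(1)[OF assms])
qed

lemma scalar_product_represents:
  fixes b :: "'e::euclidean_space \<Rightarrow> 'e \<Rightarrow> real"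
  assumes b: "scalar_product b" and k: "linear k"
  shows "\<exists>!W. \<forall>Z. b W Z = k Z"
proof -
  have "surj (lower b)"
    using b by (intro linear_inj_imp_surj linear_lower inj_lower) (rule scalar_productD)
  then obtain W where W: "lower b W = (\<Sum>i\<in>Basis. k i *\<^sub>R i)" by (metis surjD)
  have "b W Z = k Z" for Z
    using inner_lower[OF scalar_productD(1)[OF b], of W Z] linear_expand_Basis[OF k, of Z] W
    by (simp add: inner_sum_right inner_commute[of _ Z] mult.commute)
  then show ?thesis using scalar_product_eqI[OF b] by metis
qed

text \<open>
  The solution of a nondegenerate linear system whose coefficients are differentiable at \<open>p\<close> is
  differentiable at \<open>p\<close>. With \<open>S\<close> the inverse of the system at \<open>p\<close>, the solution obeys \<open>W = K - R W\<close>, where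
  \<open>K = S k\<close> is differentiable and \<open>R\<close> vanishes at \<open>p\<close>. This equation bounds \<open>W\<close> near \<open>p\<close>, hence makes it
  continuous at \<open>p\<close>, and then differentiable by \<open>has_derivative_scaleR_vanishing\<close>.
\<close>

lemma differentiable_solution:
  fixes g :: "'p::real_normed_vector \<Rightarrow> 'e::euclidean_space \<Rightarrow> 'e \<Rightarrow> real"
  assumes U: "open U" "p \<in> U" and g: "\<And>q. q \<in> U \<Longrightarrow> scalar_product (g q)"
    and dg: "\<And>X Y. (\<lambda>q. g q X Y) differentiable (at p)"
    and dk: "\<And>Z. (\<lambda>q. k q Z) differentiable (at p)"
    and W: "\<And>q Z. q \<in> U \<Longrightarrow> g q (W q) Z = k q Z"
  shows "W differentiable (at p)"
proof -
  have bil: "bilinear (g q)" if "q \<in> U" for q using g[OF that] by (rule scalar_productD)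
  obtain S where S: "linear S" "\<And>X. S (lower (g p) X) = X"
    using linear_injective_left_inverse[OF linear_lower[OF bil[OF U(2)]] inj_lower[OF g[OF U(2)]]]
    by (auto simp: fun_eq_iff)
  define K where "K q = S (\<Sum>j\<in>Basis. k q j *\<^sub>R j)" for q
  define \<Delta> where "\<Delta> q i j = g q i j - g p i j" for q and i j :: 'e
  define R where "R q X = (\<Sum>i\<in>Basis. \<Sum>j\<in>Basis. (X \<bullet> i) *\<^sub>R (\<Delta> q i j *\<^sub>R S j))" for q X
  have R: "R q X = S (lower (g q) X) - X" if "q \<in> U" for q X
  proof -
    have e: "b X j = (\<Sum>i\<in>Basis. (X \<bullet> i) * b i j)" if "bilinear b" for b :: "'e \<Rightarrow> 'e \<Rightarrow> real" and j
      using linear_expand_Basis[of "\<lambda>X. b X j" X] that by (simp add: bilinear_def)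
    have "R q X = (\<Sum>j\<in>Basis. \<Sum>i\<in>Basis. (X \<bullet> i) *\<^sub>R (\<Delta> q i j *\<^sub>R S j))"
      unfolding R_def by (rule sum.swap)
    also have "\<dots> = (\<Sum>j\<in>Basis. (g q X j - g p X j) *\<^sub>R S j)"
      using e[OF bil[OF that]] e[OF bil[OF U(2)]]
      by (simp add: \<Delta>_def scaleR_sum_left sum_subtractf[symmetric] algebra_simps)
    also have "\<dots> = S (lower (g q) X) - S (lower (g p) X)"
      using S(1) by (simp add: lower_def linear_sum linear_cmul sum_subtractf[symmetric] algebra_simps)
    finally show ?thesis using S(2) by simp
  qed
  have WK: "W q = K q - R q (W q)" if "q \<in> U" for q
  proof -
    have "K q = S (lower (g q) (W q))" by (simp add: K_def lower_def W[OF that])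
    then show ?thesis using R[OF that] by simp
  qed
  have dK: "K differentiable (at p)"
    unfolding K_def using dk
    by (intro differentiable_compose[OF linear_imp_differentiable[OF S(1)]] differentiable_sum
        differentiable_scaleR) auto
  then have cK: "isCont K p" by (rule differentiable_imp_continuous_within)
  have d\<Delta>: "(\<lambda>q. \<Delta> q i j) differentiable (at p)" for i j
    unfolding \<Delta>_def using dg by (intro differentiable_diff) auto
  have c\<Delta>: "isCont (\<lambda>q. \<Delta> q i j) p" for i j
    using d\<Delta> by (rule differentiable_imp_continuous_within)
  define r where "r q = (\<Sum>i\<in>Basis. \<Sum>j\<in>Basis. \<bar>\<Delta> q i j\<bar> * norm (S j))" for q
  have "isCont r p" unfolding r_def using c\<Delta> by (intro continuous_intros)
  moreover have "r p = 0" by (simp add: r_def \<Delta>_def)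
  ultimately have r0: "(r \<longlongrightarrow> 0) (at p)" by (metis isCont_def)
  have nR: "norm (R q X) \<le> norm X * r q" for q X
    unfolding R_def r_def sum_distrib_left
    by (intro order.trans[OF norm_sum] sum_mono)
      (auto simp: abs_mult mult.assoc[symmetric] intro!: mult_right_mono Basis_le_norm)
  have U_ev: "\<forall>\<^sub>F q in at p. q \<in> U" using U by (rule eventually_at_in_open')
  have "\<forall>\<^sub>F q in at p. r q < 1 / 2" using r0 by (rule order_tendstoD) simp
  then have bd: "\<forall>\<^sub>F q in at p. norm (R q (W q)) \<le> 2 * norm (K q) * r q"
    using U_ev
  proof eventually_elim
    case (elim q)
    have "norm (W q) \<le> norm (K q) + norm (R q (W q))"
      using WK[OF elim(2)] norm_triangle_ineq4 by metis
    also have "\<dots> \<le> norm (K q) + norm (W q) * (1 / 2)"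
      using nR[of q "W q"] mult_left_mono[of "r q" "1 / 2" "norm (W q)"] elim by simp
    finally have "norm (W q) \<le> 2 * norm (K q)" by simp
    moreover have "r q \<ge> 0" by (simp add: r_def sum_nonneg)
    ultimately show ?case using nR[of q "W q"] mult_right_mono by (metis order.trans)
  qed
  have "((\<lambda>q. 2 * norm (K q) * r q) \<longlongrightarrow> 2 * norm (K p) * 0) (at p)"
    using cK r0 by (intro tendsto_intros) (auto simp: isCont_def)
  then have R0: "((\<lambda>q. R q (W q)) \<longlongrightarrow> 0) (at p)"
    using bd by (intro Lim_null_comparison[OF bd]) simp
  have Wp: "W p = K p" using WK[OF U(2)] by (simp add: R_def \<Delta>_def)
  have "((\<lambda>q. K q - R q (W q)) \<longlongrightarrow> K p - 0) (at p)"
    using cK R0 by (intro tendsto_diff) (auto simp: isCont_def)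
  then have "(W \<longlongrightarrow> K p) (at p)"
    using tendsto_cong[of "\<lambda>q. K q - R q (W q)" W "at p"] eventually_mono[OF U_ev] WK by auto
  then have cW: "isCont W p"
    by (simp add: isCont_def Wp)
  have "(\<lambda>q. (W q \<bullet> i) *\<^sub>R (\<Delta> q i j *\<^sub>R S j)) differentiable (at p)" for i j
  proof -
    have "(\<lambda>q. \<Delta> q i j *\<^sub>R S j) differentiable (at p)"
      using d\<Delta> by (intro differentiable_scaleR) auto
    then obtain D where "((\<lambda>q. \<Delta> q i j *\<^sub>R S j) has_derivative D) (at p)"
      unfolding differentiable_def by blast
    from has_derivative_scaleR_vanishing[OF this, of "\<lambda>q. W q \<bullet> i"] cW
    show ?thesis by (auto simp: \<Delta>_def intro: differentiableI)
  qed
  then have "(\<lambda>q. K q - R q (W q)) differentiable (at p)"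
    unfolding R_def by (intro differentiable_diff dK differentiable_sum) auto
  then show ?thesis
    using differentiable_cong_open[OF U, of "\<lambda>q. K q - R q (W q)" W] WK by simp
qed

section \<open>The Levi-Civita connection in a coordinate domain\<close>

lemma smooth_onD: "smooth_on S f \<Longrightarrow> Ck_on k S f"
  by (simp add: smooth_on_def)

lemma Ck_on_differentiable: "Ck_on (Suc k) S f \<Longrightarrow> p \<in> S \<Longrightarrow> f differentiable (at p)"
  by simp

lemma smooth_on_differentiable: "smooth_on S f \<Longrightarrow> p \<in> S \<Longrightarrow> f differentiable (at p)"
  using smooth_onD Ck_on_differentiable by blast

lemma smooth_on_Der: "smooth_on S f \<Longrightarrow> smooth_on S (\<lambda>p. Der f p v)"
  unfolding smooth_on_def by (metis Ck_on.simps(2))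

locale metric_domain =
  fixes U :: "'e::euclidean_space set" and g :: "'e metric"
  assumes open_U: "open U" and metric: "metric_on U g"
begin

lemma scalar: "p \<in> U \<Longrightarrow> scalar_product (g p)"
  using metric by (simp add: metric_on_def)

lemma bil: "p \<in> U \<Longrightarrow> bilinear (g p)"
  using scalar scalar_productD by blast

lemma metric_sym: "p \<in> U \<Longrightarrow> g p X Y = g p Y X"
  using scalar scalar_productD by blast

lemma smooth: "smooth_on U (\<lambda>p. g p X Y)"
  using metric by (simp add: metric_on_def)

lemma differentiable: "p \<in> U \<Longrightarrow> (\<lambda>p. g p X Y) differentiable (at p)"
  using smooth smooth_on_differentiable by blast

definition dg :: "'e \<Rightarrow> 'e \<Rightarrow> 'e \<Rightarrow> 'e \<Rightarrow> real" where
  "dg p X Y Z = Der (\<lambda>q. g q Y Z) p X"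

lemma dg_sym: "p \<in> U \<Longrightarrow> dg p X Y Z = dg p X Z Y"
  unfolding dg_def
  using Der_cong_open[OF open_U, of p "\<lambda>q. g q Y Z" "\<lambda>q. g q Z Y"] metric_sym differentiable by auto

lemma linear_dg1: "p \<in> U \<Longrightarrow> linear (\<lambda>X. dg p X Y Z)"
  unfolding dg_def using linear_Der[OF differentiable] by (simp add: eta_contract_eq)

lemma linear_dg3:
  assumes "p \<in> U"
  shows "linear (\<lambda>Z. dg p X Y Z)"
proof (rule linearI)
  fix Z Z' and r :: real
  have "((\<lambda>q. g q Y Z + g q Y Z') has_derivative (\<lambda>v. dg p v Y Z + dg p v Y Z')) (at p)"
    unfolding dg_def by (intro has_derivative_add has_derivative_Der differentiable assms)
  then have "((\<lambda>q. g q Y (Z + Z')) has_derivative (\<lambda>v. dg p v Y Z + dg p v Y Z')) (at p)"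
    by (rule has_derivative_transform_within_open[OF _ open_U assms]) (simp add: bilinear_radd[OF bil])
  from Der_eqI[OF this, of X] show "dg p X Y (Z + Z') = dg p X Y Z + dg p X Y Z'"
    by (simp only: dg_def)
  have "((\<lambda>q. r *\<^sub>R g q Y Z) has_derivative (\<lambda>v. r *\<^sub>R dg p v Y Z)) (at p)"
    unfolding dg_def by (intro has_derivative_scaleR_right has_derivative_Der differentiable assms)
  then have "((\<lambda>q. g q Y (r *\<^sub>R Z)) has_derivative (\<lambda>v. r *\<^sub>R dg p v Y Z)) (at p)"
    by (rule has_derivative_transform_within_open[OF _ open_U assms]) (simp add: bilinear_rmul[OF bil])
  from Der_eqI[OF this, of X] show "dg p X Y (r *\<^sub>R Z) = r *\<^sub>R dg p X Y Z"
    by (simp only: dg_def)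
qed

lemma linear_dg2: "p \<in> U \<Longrightarrow> linear (\<lambda>Y. dg p X Y Z)"
  using linear_dg3[of p X Z] dg_sym[of p X] by simp

abbreviation \<Gamma> where "\<Gamma> \<equiv> christoffel g"

text \<open>
  The Koszul formula characterises the Christoffel symbols because the right hand side is linear
  in \<open>Z\<close> and hence represented by a unique vector.
\<close>

lemma koszul:
  assumes "p \<in> U"
  shows "g p (\<Gamma> p X Y) Z = (dg p X Y Z + dg p Y X Z - dg p Z X Y) / 2"
proof -
  have "linear (\<lambda>Z. (dg p X Y Z + dg p Y X Z - dg p Z X Y) /\<^sub>R 2)"
    using assms by (intro linear_compose_scale_right linear_compose_sub linear_compose_add
        linear_dg3 linear_dg1)
  then have "linear (\<lambda>Z. (dg p X Y Z + dg p Y X Z - dg p Z X Y) / 2)"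
    by (simp only: real_scaleR_def divide_inverse_commute)
  from scalar_product_represents[OF scalar[OF assms] this]
  have "\<exists>!W. \<forall>Z. g p W Z = (dg p X Y Z + dg p Y X Z - dg p Z X Y) / 2" .
  from theI'[OF this] show ?thesis
    unfolding christoffel_def dg_def by blast
qed

lemma christoffel_sym:
  assumes p: "p \<in> U"
  shows "\<Gamma> p X Y = \<Gamma> p Y X"
proof (rule scalar_product_eqI[OF scalar[OF p]])
  show "g p (\<Gamma> p X Y) Z = g p (\<Gamma> p Y X) Z" for Z
    unfolding koszul[OF p] using dg_sym[OF p, of Z X Y] by simp
qed

text \<open>
  The metric is parallel: adding the two Koszul formulas, all terms but one cancel.
\<close>

lemma christoffel_metric:
  assumes p: "p \<in> U"
  shows "dg p X Y Z = g p (\<Gamma> p X Y) Z + g p Y (\<Gamma> p X Z)"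
  unfolding metric_sym[OF p, of Y] koszul[OF p]
  using dg_sym[OF p, of X Z Y] dg_sym[OF p, of Y X Z] dg_sym[OF p, of Z X Y] by (simp add: field_simps)

lemma linear_christoffel:
  assumes p: "p \<in> U"
  shows "linear (\<Gamma> p X)"
proof (rule linearI)
  note l = linear_dg1[OF p] linear_dg2[OF p] linear_dg3[OF p]
  note add = l[THEN linear_add] and cmul = l[THEN linear_cmul]
  show "\<Gamma> p X (Y + Z) = \<Gamma> p X Y + \<Gamma> p X Z" for Y Z
    by (rule scalar_product_eqI[OF scalar[OF p]])
      (simp add: koszul[OF p] bilinear_ladd[OF bil[OF p]] add field_simps)
  show "\<Gamma> p X (r *\<^sub>R Y) = r *\<^sub>R \<Gamma> p X Y" for r Y
    by (rule scalar_product_eqI[OF scalar[OF p]])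
      (simp add: koszul[OF p] bilinear_lmul[OF bil[OF p]] cmul field_simps)
qed

lemma bilinear_christoffel: "p \<in> U \<Longrightarrow> bilinear (\<Gamma> p)"
  unfolding bilinear_def using linear_christoffel christoffel_sym by auto

lemma differentiable_christoffel:
  assumes p: "p \<in> U"
  shows "(\<lambda>q. \<Gamma> q X Y) differentiable (at p)"
proof (rule differentiable_solution[OF open_U p scalar differentiable[OF p],
      where k = "\<lambda>q Z. (dg q X Y Z + dg q Y X Z - dg q Z X Y) / 2"])
  show "(\<lambda>q. (dg q X Y Z + dg q Y X Z - dg q Z X Y) / 2) differentiable (at p)" for Z
    unfolding dg_def using smooth_on_differentiable[OF smooth_on_Der[OF smooth] p]
    by (intro differentiable_divide differentiable_diff differentiable_add) auto
qed (simp_all only: koszul)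

lemma curvature_christoffel:
  "p \<in> U \<Longrightarrow> curvature g p X Y Z =
    Der (\<lambda>q. \<Gamma> q Y Z) p X + \<Gamma> p X (\<Gamma> p Y Z) - (Der (\<lambda>q. \<Gamma> q X Z) p Y + \<Gamma> p Y (\<Gamma> p X Z))"
  by (simp add: curvature_def nabla_def)

end

section \<open>The covariant derivative along a parametrised surface\<close>

locale surface_domain = metric_domain U g for U :: "(complex^2) set" and g +
  fixes S :: "(real^2) set" and F :: "real^2 \<Rightarrow> complex^2"
  assumes open_S: "open S" and smooth_F: "smooth_on S F" and F_in: "u \<in> S \<Longrightarrow> F u \<in> U"
begin

abbreviation nab :: "real^2 \<Rightarrow> real^2 \<Rightarrow> (real^2 \<Rightarrow> complex^2) \<Rightarrow> complex^2" where
  "nab \<equiv> nabla_along g F"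

lemmas bilF = bil[OF F_in]
lemmas bil_christoffelF = bilinear_christoffel[OF F_in]

lemma differentiable_F: "u \<in> S \<Longrightarrow> F differentiable (at u)"
  using smooth_F smooth_on_differentiable by blast

lemma differentiable_Der_F: "u \<in> S \<Longrightarrow> (\<lambda>w. Der F w Y) differentiable (at u)"
  using smooth_on_Der[OF smooth_F] smooth_on_differentiable by blast

lemma linear_Der_F: "u \<in> S \<Longrightarrow> linear (Der F u)"
  using linear_Der differentiable_F by blast

lemma linear_nabla_along:
  assumes u: "u \<in> S" and V: "V differentiable (at u)"
  shows "linear (\<lambda>X. nab u X V)"
proof -
  have "linear (\<lambda>X. \<Gamma> (F u) X (V u))"
    using bil_christoffelF[OF u] by (simp add: bilinear_def)
  from linear_compose[OF linear_Der_F[OF u] this]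
  have "linear (\<lambda>X. \<Gamma> (F u) (Der F u X) (V u))" by (simp add: o_def)
  then show ?thesis
    unfolding nabla_along_def by (intro linear_compose_add linear_Der V)
qed

lemma nabla_along_add:
  assumes "u \<in> S" "V differentiable (at u)" "W differentiable (at u)"
  shows "nab u X (\<lambda>w. V w + W w) = nab u X V + nab u X W"
  using Der_eqI[OF has_derivative_add[OF assms(2,3)[THEN has_derivative_Der]], of X]
  by (simp add: nabla_along_def bilinear_radd[OF bil_christoffelF[OF assms(1)]])

lemma nabla_along_scaleR:
  assumes "u \<in> S" "V differentiable (at u)"
  shows "nab u X (\<lambda>w. r *\<^sub>R V w) = r *\<^sub>R nab u X V"
  using Der_eqI[OF has_derivative_scaleR_right[OF assms(2)[THEN has_derivative_Der]], of r X]
  by (simp add: nabla_along_def bilinear_rmul[OF bil_christoffelF[OF assms(1)]] scaleR_add_right)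

lemma nabla_along_metric:
  assumes u: "u \<in> S" and V: "V differentiable (at u)" and W: "W differentiable (at u)"
  shows "Der (\<lambda>w. g (F w) (V w) (W w)) u X = g (F u) (nab u X V) (W u) + g (F u) (V u) (nab u X W)"
proof -
  have "Der (\<lambda>w. g (F w) (V w) (W w)) u X =
    dg (F u) (Der F u X) (V u) (W u) + g (F u) (Der V u X) (W u) + g (F u) (V u) (Der W u X)"
    unfolding dg_def
    by (rule Der_eqI, rule has_derivative_bilinear_family_along[where B = g and F = F, OF open_S u bilF differentiable[OF F_in[OF u]]])
      (use differentiable_F[OF u] V W in \<open>auto intro: has_derivative_Der\<close>)
  then show ?thesis
    by (simp add: christoffel_metric[OF F_in[OF u]] nabla_along_def
        bilinear_ladd[OF bilF[OF u]] bilinear_radd[OF bilF[OF u]])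
qed

text \<open>
  The two terms are the summands of the derivative of a constant function, by \<open>nabla_along_metric\<close>.
\<close>

lemma nabla_along_metric_const:
  assumes u: "u \<in> S" and V: "V differentiable (at u)" and W: "W differentiable (at u)"
    and const: "\<And>w. w \<in> S \<Longrightarrow> g (F w) (V w) (W w) = c"
  shows "g (F u) (nab u X V) (W u) + g (F u) (V u) (nab u X W) = 0"
proof -
  have "Der (\<lambda>_. c) u = Der (\<lambda>w. g (F w) (V w) (W w)) u"
    by (rule Der_cong_open[OF open_S u]) (use const in auto)
  then show ?thesis
    using nabla_along_metric[OF u V W, of X] by (metis frechet_derivative_const)
qed

lemma nabla_along_torsion_free:
  assumes u: "u \<in> S"
  shows "nab u X (\<lambda>w. Der F w Y) = nab u Y (\<lambda>w. Der F w X)"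
  unfolding nabla_along_def
  using second_derivative_symmetric[OF open_S u smooth_onD[OF smooth_F]]
    christoffel_sym[OF F_in[OF u]] by simp

lemma has_derivative_Der_F:
  assumes u: "u \<in> S" and e: "e differentiable (at u)"
  shows "((\<lambda>w. Der F w (e w)) has_derivative
    (\<lambda>X. Der (\<lambda>w. Der F w (e u)) u X + Der F u (Der e u X))) (at u)"
  by (rule has_derivative_linear_family[OF open_S u linear_Der_F])
    (use differentiable_Der_F[OF u] e in \<open>auto intro: has_derivative_Der\<close>)

lemma nabla_along_tangent_field:
  assumes u: "u \<in> S" and e: "e differentiable (at u)"
  shows "nab u X (\<lambda>w. Der F w (e w)) = nab u X (\<lambda>w. Der F w (e u)) + Der F u (Der e u X)"
  by (simp add: nabla_along_def Der_eqI[OF has_derivative_Der_F[OF assms]])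

lemma Ck_on_tangent_field:
  assumes e: "Ck_on k S e"
  shows "Ck_on k S (\<lambda>w. Der F w (e w))"
proof (rule Ck_on_cong[OF open_S])
  have "bounded_linear (\<lambda>x::real^2. x \<bullet> i)" for i by (rule bounded_linear_inner_left)
  then show "Ck_on k S (\<lambda>w. \<Sum>i\<in>Basis. (e w \<bullet> i) *\<^sub>R Der F w i)"
    by (intro Ck_on_sum Ck_on_scaleR open_S Ck_on_bounded_linear[OF open_S _ e]
        smooth_onD smooth_on_Der smooth_F) auto
  show "(\<Sum>i\<in>Basis. (e w \<bullet> i) *\<^sub>R Der F w i) = Der F w (e w)" if "w \<in> S" for w
    using linear_expand_Basis[OF linear_Der_F[OF that], of "e w"] by simp
qed

lemma has_derivative_nabla_along:
  assumes u: "u \<in> S" and V: "Ck_on 2 S V"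
  shows "((\<lambda>w. nab w Y V) has_derivative (\<lambda>h. Der (\<lambda>w. Der V w Y) u h +
    (Der (\<lambda>q. \<Gamma> q (Der F u Y) (V u)) (F u) (Der F u h) + \<Gamma> (F u) (Der (\<lambda>w. Der F w Y) u h) (V u)
      + \<Gamma> (F u) (Der F u Y) (Der V u h)))) (at u)"
  unfolding nabla_along_def
proof (rule has_derivative_add)
  show "((\<lambda>w. Der V w Y) has_derivative Der (\<lambda>w. Der V w Y) u) (at u)"
    using V u by (intro has_derivative_Der) (auto simp: numeral_2_eq_2)
  have "V differentiable (at u)" using V u by (auto simp: numeral_2_eq_2)
  then show "((\<lambda>w. \<Gamma> (F w) (Der F w Y) (V w)) has_derivative
    (\<lambda>h. Der (\<lambda>q. \<Gamma> q (Der F u Y) (V u)) (F u) (Der F u h) + \<Gamma> (F u) (Der (\<lambda>w. Der F w Y) u h) (V u)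
      + \<Gamma> (F u) (Der F u Y) (Der V u h))) (at u)"
    by (intro has_derivative_bilinear_family_along[where B = \<Gamma> and F = F, OF open_S u bil_christoffelF
          differentiable_christoffel[OF F_in[OF u]]] has_derivative_Der differentiable_F
        differentiable_Der_F u) auto
qed

lemma differentiable_nabla_along:
  "u \<in> S \<Longrightarrow> Ck_on 2 S V \<Longrightarrow> (\<lambda>w. nab w Y V) differentiable (at u)"
  using has_derivative_nabla_along differentiableI by blast

text \<open>
  Along a map, the ambient curvature measures the commutator of the covariant derivatives in two
  constant directions. Expanding both orders, the terms with second derivatives of \<open>V\<close> and of \<open>F\<close> cancel
  by symmetry, the mixed terms with one derivative of \<open>V\<close> cancel in pairs, and what remains is the
  coordinate formula for the curvature.
\<close>

proposition nabla_along_commute: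
  assumes u: "u \<in> S" and V: "Ck_on 2 S V"
  shows "nab u X (\<lambda>w. nab w Y V) - nab u Y (\<lambda>w. nab w X V) =
    curvature g (F u) (Der F u X) (Der F u Y) (V u)"
proof -
  have D: "nab u X (\<lambda>w. nab w Y V) = Der (\<lambda>w. Der V w Y) u X +
    (Der (\<lambda>q. \<Gamma> q (Der F u Y) (V u)) (F u) (Der F u X) + \<Gamma> (F u) (Der (\<lambda>w. Der F w Y) u X) (V u)
      + \<Gamma> (F u) (Der F u Y) (Der V u X)) +
    (\<Gamma> (F u) (Der F u X) (Der V u Y) + \<Gamma> (F u) (Der F u X) (\<Gamma> (F u) (Der F u Y) (V u)))" for X Y
    unfolding nabla_along_def[of g F u X "\<lambda>w. nab w Y V"] Der_eqI[OF has_derivative_nabla_along[OF assms]]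
    by (simp add: nabla_along_def bilinear_radd[OF bil_christoffelF[OF u]])
  show ?thesis
    unfolding D curvature_christoffel[OF F_in[OF u]]
      second_derivative_symmetric[OF open_S u V, of Y X]
      second_derivative_symmetric[OF open_S u smooth_onD[OF smooth_F], of Y X]
    by simp
qed

end

section \<open>Null pairs in a Hermitian plane\<close>

lemma J_algebra [simp]:
  "J (X + Y) = J X + J Y" "J (X - Y) = J X - J Y" "J (- X) = - J X"
  "J (r *\<^sub>R X) = r *\<^sub>R J X" "J (J X) = - X"
  by (simp_all add: J_def vec_eq_iff algebra_simps)

lemma linear_J: "linear J"
  by (rule linearI) simp_all

lemma bounded_linear_J: "bounded_linear J"
  using linear_J by (simp add: linear_conv_bounded_linear)

locale hermitian_product =
  fixes b :: "complex^2 \<Rightarrow> complex^2 \<Rightarrow> real"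
  assumes scalar: "scalar_product b" and J_isometry: "b (J X) (J Y) = b X Y"
begin

lemmas bil = scalar_productD(1)[OF scalar]
lemmas expand = bilinear_ladd[OF bil] bilinear_radd[OF bil] bilinear_lsub[OF bil] bilinear_rsub[OF bil]
  bilinear_lneg[OF bil] bilinear_rneg[OF bil] bilinear_lmul[OF bil] bilinear_rmul[OF bil]
  bilinear_lzero[OF bil] bilinear_rzero[OF bil]

lemma commute: "b X Y = b Y X"
  using scalar by (rule scalar_productD)

lemma J_skew: "b (J X) Y = - b X (J Y)"
  using J_isometry[of X "J Y"] by (simp add: expand)

lemma J_self: "b (J X) X = 0" "b X (J X) = 0"
  using J_skew[of X X] commute[of "J X" X] by auto

end

text \<open>
  The linear algebra at one point of a slant surface; \<open>s\<close> is the hyperbolic sine of the Wirtinger angle.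
\<close>

locale slant_null_pair = hermitian_product +
  fixes E1 E2 :: "complex^2" and s :: real
  assumes null: "b E1 E1 = 0" "b E2 E2 = 0" and pairing: "b E1 E2 = - 1"
    and slant: "b (J E1) E2 = - s"
begin

lemma products:
  "b E1 E1 = 0" "b E2 E2 = 0" "b E1 E2 = - 1" "b E2 E1 = - 1"
  "b (J E1) E1 = 0" "b E1 (J E1) = 0" "b (J E2) E2 = 0" "b E2 (J E2) = 0"
  "b (J E1) E2 = - s" "b E2 (J E1) = - s" "b (J E2) E1 = s" "b E1 (J E2) = s"
  using null pairing slant J_self J_skew[of E1 E2] commute[of E2 E1] commute[of E2 "J E1"]
    commute[of "J E2" E1] by auto

text \<open>
  These are the normal parts of \<open>J E1\<close> and \<open>J E2\<close>, a null frame of the normal plane.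
\<close>

definition n1 where "n1 = J E1 - s *\<^sub>R E1"
definition n2 where "n2 = J E2 + s *\<^sub>R E2"

text \<open>
  The vectors \<open>E1\<close>, \<open>J E1\<close>, \<open>E2\<close>, \<open>J E2\<close> form a real basis: their combination \<open>T X\<close> determines the four
  coefficients, since the Gram matrix has determinant \<open>(1 + s\<^sup>2)\<^sup>2\<close>. Hence only \<open>0\<close> is orthogonal
  to all of them.
\<close>

lemma orthogonal_frame_imp_0:
  assumes d: "b d E1 = 0" "b d E2 = 0" "b d (J E1) = 0" "b d (J E2) = 0"
  shows "d = 0"
proof -
  define T :: "complex^2 \<Rightarrow> complex^2" where "T X = Re (X $ 1) *\<^sub>R E1 + Im (X $ 1) *\<^sub>R J E1
    + Re (X $ 2) *\<^sub>R E2 + Im (X $ 2) *\<^sub>R J E2" for X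
  have T: "linear T"
    by (rule linearI) (simp_all add: T_def algebra_simps)
  have "inj T"
    unfolding linear_injective_0[OF T]
  proof (intro allI impI)
    fix X assume X: "T X = 0"
    have "b (T X) E1 = 0" "b (T X) E2 = 0" "b (T X) (J E1) = 0" "b (T X) (J E2) = 0"
      using X by (simp_all add: expand)
    then have *: "Re (X $ 2) = s * Im (X $ 2)" "Re (X $ 1) = - s * Im (X $ 1)"
      "Im (X $ 2) = - s * Re (X $ 2)" "Im (X $ 1) = s * Re (X $ 1)"
      by (auto simp: T_def expand products J_isometry mult.commute[of _ s])
    have "(1 + s * s) * Re (X $ 1) = 0" "(1 + s * s) * Re (X $ 2) = 0"
      using * by (auto simp: algebra_simps)
    moreover have "1 + s * s \<noteq> 0" using add_pos_nonneg[of 1 "s * s"] by simp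
    ultimately have "Re (X $ 1) = 0" "Re (X $ 2) = 0" by simp_all
    with * show "X = 0" by (auto simp: vec_eq_iff forall_2 complex_eq_iff)
  qed
  then have "surj T" using T by (rule linear_inj_imp_surj[rotated])
  have "b d Y = 0" for Y
  proof -
    obtain X where "Y = T X" using \<open>surj T\<close> by (metis surjD)
    then show ?thesis using d by (simp add: T_def expand)
  qed
  then show ?thesis using scalar_productD(3)[OF scalar] by blast
qed

lemma n_products:
  "b n1 E1 = 0" "b n1 E2 = 0" "b n2 E1 = 0" "b n2 E2 = 0" "b n1 n1 = 0" "b n2 n2 = 0"
  "b n1 n2 = - (1 + s * s)" "b n2 n1 = - (1 + s * s)"
  "b E1 n1 = 0" "b E2 n1 = 0" "b E1 n2 = 0" "b E2 n2 = 0"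
  by (simp_all add: n1_def n2_def expand products J_isometry algebra_simps)

lemma J_normal: "J n1 + s *\<^sub>R n1 = - (1 + s * s) *\<^sub>R E1"
  by (simp add: n1_def algebra_simps)

lemma null_frame_decompose:
  "X = (- b X E2) *\<^sub>R E1 + (- b X E1) *\<^sub>R E2
     + (- b X n2 / (1 + s * s)) *\<^sub>R n1 + (- b X n1 / (1 + s * s)) *\<^sub>R n2" (is "X = ?Y")
proof -
  have "1 + s * s \<noteq> 0" using add_pos_nonneg[of 1 "s * s"] by simp
  then have E: "b (X - ?Y) E1 = 0" "b (X - ?Y) E2 = 0"
    and n: "b (X - ?Y) n1 = 0" "b (X - ?Y) n2 = 0"
    by (simp_all add: expand n_products products field_simps)
  have "J E1 = n1 + s *\<^sub>R E1" "J E2 = n2 - s *\<^sub>R E2" by (simp_all add: n1_def n2_def)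
  then have "b (X - ?Y) (J E1) = 0" "b (X - ?Y) (J E2) = 0"
    using E n by (simp_all only: expand) simp_all
  with E have "X - ?Y = 0" by (intro orthogonal_frame_imp_0)
  then show ?thesis by simp
qed

text \<open>
  By the hypotheses \<open>D1\<close> lies in the plane of \<open>E1\<close> and \<open>n2\<close>, and \<open>D2\<close> in that of \<open>E2\<close> and \<open>n1\<close>. The map
  \<open>J + s\<close> sends \<open>E2\<close> to \<open>n2\<close> and \<open>n1\<close> to a multiple of \<open>E1\<close>, so it takes \<open>D2\<close> into the first plane too, and
  that plane is totally null.
\<close>

lemma codazzi_term_vanishes:
  assumes "b D1 E1 = 0" "b D1 n2 = 0" "b D2 E2 = 0" "b D2 n1 = 0"
  shows "b D1 (J D2 + s *\<^sub>R D2) = 0"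
proof -
  have "D1 = (- b D1 E2) *\<^sub>R E1 + (- b D1 n1 / (1 + s * s)) *\<^sub>R n2"
    using null_frame_decompose[of D1] assms by simp
  then obtain p q where D1: "D1 = p *\<^sub>R E1 + q *\<^sub>R n2" by blast
  have "D2 = (- b D2 E1) *\<^sub>R E2 + (- b D2 n2 / (1 + s * s)) *\<^sub>R n1"
    using null_frame_decompose[of D2] assms by simp
  then obtain r t where D2: "D2 = r *\<^sub>R E2 + t *\<^sub>R n1" by blast
  have "J D2 + s *\<^sub>R D2 = r *\<^sub>R n2 + t *\<^sub>R (J n1 + s *\<^sub>R n1)"
    by (simp add: D2 n2_def algebra_simps)
  then show ?thesis
    unfolding J_normal by (simp add: D1 expand n_products products)
qed

text \<open>
  The vector on the left is \<open>R(E1, E2) E1\<close> in a complex space form of holomorphic curvature \<open>4c\<close>.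
\<close>

lemma curvature_term:
  "b (c *\<^sub>R (b E2 E1 *\<^sub>R E1 - b E1 E1 *\<^sub>R E2 + b (J E2) E1 *\<^sub>R J E1 - b (J E1) E1 *\<^sub>R J E2
      + (2 * b E1 (J E2)) *\<^sub>R J E1)) n2 = - 3 * c * s * (1 + s * s)"
  by (simp add: products expand n2_def J_isometry algebra_simps)

end

section \<open>Null frames of a two-dimensional metric\<close>

lemma linear_expand_axis:
  fixes f :: "real^'n \<Rightarrow> 'b::real_vector"
  assumes "linear f"
  shows "f X = (\<Sum>i\<in>UNIV. (X $ i) *\<^sub>R f (axis i 1))"
proof -
  have "f X = f (\<Sum>i\<in>UNIV. (X $ i) *\<^sub>R axis i 1)"
    by (simp add: basis_expansion[of X, unfolded scalar_mult_eq_scaleR])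
  also have "\<dots> = (\<Sum>i\<in>UNIV. (X $ i) *\<^sub>R f (axis i 1))"
    by (simp add: linear_sum[OF assms] linear_cmul[OF assms])
  finally show ?thesis .
qed

lemma bilinear_expand_axis:
  fixes h :: "real^'n \<Rightarrow> real^'n \<Rightarrow> 'b::real_vector"
  assumes "bilinear h"
  shows "h X Y = (\<Sum>i\<in>UNIV. \<Sum>j\<in>UNIV. (X $ i * Y $ j) *\<^sub>R h (axis i 1) (axis j 1))"
proof -
  have "linear (\<lambda>X. h X Y)" and l: "linear (h Z)" for Z using assms by (auto simp: bilinear_def)
  from linear_expand_axis[OF this(1), of X]
  show ?thesis
    by (simp add: linear_expand_axis[OF l, of _ Y] scaleR_sum_right)
qed

lemma null_frame_expand:
  fixes G :: "real^2 \<Rightarrow> real^2 \<Rightarrow> real"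
  assumes G: "bilinear G" and sym: "\<And>X Y. G X Y = G Y X"
    and e: "G e1 e1 = 0" "G e2 e2 = 0" "G e1 e2 = - 1"
  shows "X = - (G X e2 *\<^sub>R e1) - G X e1 *\<^sub>R e2"
proof -
  note expand = bilinear_ladd[OF G] bilinear_lmul[OF G]
  define T :: "real^2 \<Rightarrow> real^2" where "T X = X $ 1 *\<^sub>R e1 + X $ 2 *\<^sub>R e2" for X
  have GT: "G (T X) e1 = - X $ 2" "G (T X) e2 = - X $ 1" for X
    using e sym[of e2 e1] by (simp_all add: T_def expand)
  have T: "linear T"
    by (rule linearI) (simp_all add: T_def algebra_simps)
  have "inj T"
    unfolding linear_injective_0[OF T]
  proof (intro allI impI)
    fix X assume TX: "T X = 0"
    show "X = 0" using GT[of X] unfolding TX by (simp add: vec_eq_iff forall_2 bilinear_lzero[OF G])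
  qed
  then have "surj T" using T by (rule linear_inj_imp_surj[rotated])
  then obtain Y where "X = T Y" by (metis surjD)
  then show ?thesis using GT[of Y] by (simp add: T_def)
qed

lemma matrix_inv_eqI:
  fixes A B :: "'a::semiring_1^'n^'n"
  assumes AB: "A ** B = mat 1" and BA: "B ** A = mat 1"
  shows "matrix_inv A = B"
proof -
  have "A ** matrix_inv A = mat 1"
    unfolding matrix_inv_def by (rule someI2[of _ B]) (use AB BA in auto)
  then have "B ** (A ** matrix_inv A) = B" by simp
  then show ?thesis using BA by (simp add: matrix_mul_assoc)
qed

text \<open>
  The trace of a bilinear form \<open>h\<close> with respect to \<open>G\<close> can be read off a null frame, because the inverse
  of the Gram matrix of the coordinate basis is \<open>- (e1 e2\<^sup>T + e2 e1\<^sup>T)\<close>.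
\<close>

lemma trace_null_frame:
  fixes G :: "real^2 \<Rightarrow> real^2 \<Rightarrow> real" and h :: "real^2 \<Rightarrow> real^2 \<Rightarrow> 'b::real_vector"
  assumes G: "bilinear G" and sym: "\<And>X Y. G X Y = G Y X" and h: "bilinear h"
    and e: "G e1 e1 = 0" "G e2 e2 = 0" "G e1 e2 = - 1"
  shows "(\<Sum>i\<in>UNIV. \<Sum>j\<in>UNIV. (matrix_inv (\<chi> i j. G (axis i 1) (axis j 1)) $ i $ j) *\<^sub>R
      h (axis i 1) (axis j 1)) = - (h e1 e2 + h e2 e1)"
proof -
  define A :: "real^2^2" where "A = (\<chi> i j. G (axis i 1) (axis j 1))"
  define B :: "real^2^2" where "B = (\<chi> i j. - (e1 $ i * e2 $ j + e2 $ i * e1 $ j))"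
  have lin: "linear (\<lambda>X. G X Y)" for Y using G by (simp add: bilinear_def)
  have "(B ** A) $ i $ j = mat 1 $ i $ j" for i j
  proof -
    have "(B ** A) $ i $ j = - (\<Sum>k\<in>UNIV. e1 $ i * (e2 $ k * G (axis k 1) (axis j 1))
        + e2 $ i * (e1 $ k * G (axis k 1) (axis j 1)))"
      unfolding matrix_matrix_mult_def A_def B_def sum_negf[symmetric]
      by (auto simp: algebra_simps intro!: sum.cong)
    also have "\<dots> = - (e1 $ i * G e2 (axis j 1) + e2 $ i * G e1 (axis j 1))"
      unfolding linear_expand_axis[OF lin, of e1] linear_expand_axis[OF lin, of e2]
      by (simp add: sum.distrib sum_distrib_left)
    also have "\<dots> = (- (G (axis j 1) e2 *\<^sub>R e1) - G (axis j 1) e1 *\<^sub>R e2) $ i"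
      by (simp add: sym[of "axis j 1"])
    also have "\<dots> = axis j 1 $ i"
      using null_frame_expand[OF G sym e, of "axis j 1"] by simp
    finally show ?thesis by (simp add: mat_def axis_def)
  qed
  then have BA: "B ** A = mat 1" by (simp add: vec_eq_iff)
  then have "matrix_inv A = B"
    by (intro matrix_inv_eqI) (simp_all add: matrix_left_right_inverse)
  then have "(\<Sum>i\<in>UNIV. \<Sum>j\<in>UNIV. (matrix_inv A $ i $ j) *\<^sub>R h (axis i 1) (axis j 1)) =
    - ((\<Sum>i\<in>UNIV. \<Sum>j\<in>UNIV. (e1 $ i * e2 $ j) *\<^sub>R h (axis i 1) (axis j 1)) +
       (\<Sum>i\<in>UNIV. \<Sum>j\<in>UNIV. (e2 $ i * e1 $ j) *\<^sub>R h (axis i 1) (axis j 1)))"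
    by (simp add: B_def scaleR_left_diff_distrib sum_subtractf sum_negf)
  then show ?thesis
    unfolding A_def bilinear_expand_axis[OF h, symmetric] .
qed

section \<open>Null frames on a surface in a Kaehler domain\<close>

locale kaehler_surface = surface_domain +
  assumes isometry: "p \<in> U \<Longrightarrow> g p (J X) (J Y) = g p X Y"
    and christoffel_J: "p \<in> U \<Longrightarrow> christoffel g p X (J Y) = J (christoffel g p X Y)"
begin

lemma hermitian: "u \<in> S \<Longrightarrow> hermitian_product (g (F u))"
  using F_in isometry scalar by (simp add: hermitian_product_def)

lemma differentiable_J: "V differentiable (at u) \<Longrightarrow> (\<lambda>w. J (V w)) differentiable (at u)"
  using bounded_linear.has_derivative[OF bounded_linear_J] unfolding differentiable_def by blast

lemma nabla_along_J:
  assumes u: "u \<in> S" and V: "V differentiable (at u)"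
  shows "nab u X (\<lambda>w. J (V w)) = J (nab u X V)"
proof -
  have "Der (\<lambda>w. J (V w)) u X = J (Der V u X)"
    by (rule Der_eqI) (rule bounded_linear.has_derivative[OF bounded_linear_J has_derivative_Der[OF V]])
  then show ?thesis by (simp add: nabla_along_def christoffel_J[OF F_in[OF u]])
qed

end

locale null_framed_surface = kaehler_surface +
  fixes e1 e2 :: "real^2 \<Rightarrow> real^2"
  assumes frame: "null_frame_on g F S e1 e2"
begin

definition E1 where "E1 u = Der F u (e1 u)"
definition E2 where "E2 u = Der F u (e2 u)"

lemma Ck_E: "Ck_on k S E1" "Ck_on k S E2"
  unfolding E1_def E2_def
  by (intro Ck_on_tangent_field smooth_onD; use frame in \<open>auto simp: null_frame_on_def\<close>)+

lemma differentiable_E: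
  "u \<in> S \<Longrightarrow> E1 differentiable (at u)" "u \<in> S \<Longrightarrow> E2 differentiable (at u)"
  using Ck_E[of "Suc 0"] by auto

lemma differentiable_e:
  "u \<in> S \<Longrightarrow> e1 differentiable (at u)" "u \<in> S \<Longrightarrow> e2 differentiable (at u)"
  using frame smooth_on_differentiable by (auto simp: null_frame_on_def)

lemma null_E:
  assumes "u \<in> S"
  shows "g (F u) (E1 u) (E1 u) = 0" "g (F u) (E2 u) (E2 u) = 0" "g (F u) (E1 u) (E2 u) = - 1"
    "g (F u) (E2 u) (E1 u) = - 1"
  using frame assms metric_sym[OF F_in[OF assms], of "E2 u" "E1 u"]
  by (auto simp: null_frame_on_def induced_metric_def E1_def E2_def)

lemma bilinear_induced: "u \<in> S \<Longrightarrow> bilinear (induced_metric g F u)"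
  unfolding induced_metric_def bilinear_def
  using bilF[of u] linear_compose[OF linear_Der_F, of u] by (auto simp: bilinear_def o_def)

lemma induced_sym: "u \<in> S \<Longrightarrow> induced_metric g F u X Y = induced_metric g F u Y X"
  unfolding induced_metric_def using metric_sym F_in by blast

lemma frame_expand:
  assumes u: "u \<in> S"
  shows "X = - (g (F u) (Der F u X) (E2 u) *\<^sub>R e1 u) - g (F u) (Der F u X) (E1 u) *\<^sub>R e2 u"
  using null_frame_expand[OF bilinear_induced[OF u] induced_sym[OF u], of "e1 u" "e2 u" X] frame u
  by (auto simp: null_frame_on_def induced_metric_def E1_def E2_def)

lemma tangent_expand:
  assumes u: "u \<in> S"
  shows "Der F u X = - (g (F u) (Der F u X) (E2 u) *\<^sub>R E1 u) - g (F u) (Der F u X) (E1 u) *\<^sub>R E2 u"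
proof -
  note l = linear_Der_F[OF u]
  have "Der F u X = Der F u (- (g (F u) (Der F u X) (E2 u) *\<^sub>R e1 u) - g (F u) (Der F u X) (E1 u) *\<^sub>R e2 u)"
    using frame_expand[OF u, of X] by simp
  then show ?thesis
    by (simp add: linear_diff[OF l] linear_neg[OF l] linear_cmul[OF l] E1_def E2_def)
qed

lemma normal_iff:
  assumes u: "u \<in> S"
  shows "\<xi> \<in> normal_space g F u \<longleftrightarrow> g (F u) \<xi> (E1 u) = 0 \<and> g (F u) \<xi> (E2 u) = 0"
proof
  assume "\<xi> \<in> normal_space g F u"
  then show "g (F u) \<xi> (E1 u) = 0 \<and> g (F u) \<xi> (E2 u) = 0"
    by (auto simp: normal_space_def tangent_space_def E1_def E2_def)
next
  note b = bilF[OF u]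
  assume a: "g (F u) \<xi> (E1 u) = 0 \<and> g (F u) \<xi> (E2 u) = 0"
  have "g (F u) \<xi> (Der F u X) = 0" for X
    by (subst tangent_expand[OF u])
      (simp add: a bilinear_rsub[OF b] bilinear_rneg[OF b] bilinear_rmul[OF b])
  then show "\<xi> \<in> normal_space g F u"
    by (auto simp: normal_space_def tangent_space_def)
qed

text \<open>
  The formula is the orthogonal projection in a null frame, and it makes the tangential part linear.
\<close>

lemma tangential_eq:
  assumes u: "u \<in> S"
  shows "tangential g F u v = - (g (F u) v (E2 u) *\<^sub>R E1 u) - g (F u) v (E1 u) *\<^sub>R E2 u"
    (is "_ = ?t")
  unfolding tangential_def
proof (rule the_equality, rule conjI)
  note b = bilF[OF u] and l = linear_Der_F[OF u]
  note expand = bilinear_lsub[OF b] bilinear_lneg[OF b] bilinear_lmul[OF b]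
  have "?t = Der F u (- (g (F u) v (E2 u) *\<^sub>R e1 u) - g (F u) v (E1 u) *\<^sub>R e2 u)"
    by (simp add: linear_diff[OF l] linear_neg[OF l] linear_cmul[OF l] E1_def E2_def)
  then show "?t \<in> tangent_space F u" by (auto simp: tangent_space_def)
  show "v - ?t \<in> normal_space g F u"
    by (simp add: normal_iff[OF u] expand null_E[OF u])
  fix t assume t: "t \<in> tangent_space F u \<and> v - t \<in> normal_space g F u"
  then have "g (F u) t (E1 u) = g (F u) v (E1 u)" "g (F u) t (E2 u) = g (F u) v (E2 u)"
    by (auto simp: normal_iff[OF u] expand)
  moreover obtain X where "t = Der F u X" using t by (auto simp: tangent_space_def)
  ultimately show "t = ?t" using tangent_expand[OF u, of X] by simp
qed

lemma tangential_in: "u \<in> S \<Longrightarrow> tangential g F u v \<in> tangent_space F u"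
proof -
  assume u: "u \<in> S"
  note l = linear_Der_F[OF u]
  have "tangential g F u v = Der F u (- (g (F u) v (E2 u) *\<^sub>R e1 u) - g (F u) v (E1 u) *\<^sub>R e2 u)"
    by (simp add: tangential_eq[OF u] linear_diff[OF l] linear_neg[OF l] linear_cmul[OF l] E1_def E2_def)
  then show ?thesis by (auto simp: tangent_space_def)
qed

lemma wirtinger_angle:
  assumes u: "u \<in> S" and P: "P g F u (e1 u) = s *\<^sub>R E1 u"
  shows "g (F u) (J (E1 u)) (E2 u) = - s"
proof -
  note b = bilF[OF u]
  have "g (F u) (P g F u (e1 u)) (E2 u) = g (F u) (J (E1 u)) (E2 u)"
    by (simp add: P_def tangential_eq[OF u] E1_def[symmetric] null_E[OF u]
        bilinear_lsub[OF b] bilinear_lneg[OF b] bilinear_lmul[OF b])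
  then show ?thesis
    by (simp add: P bilinear_lmul[OF b] null_E[OF u])
qed

lemma
  assumes u: "u \<in> S"
  shows second_form_sym: "second_form g F u X Y = second_form g F u Y X"
    and bilinear_second_form: "bilinear (second_form g F u)"
proof -
  note b = bilF[OF u]
  have sym: "second_form g F u X Y = second_form g F u Y X" for X Y
    unfolding second_form_def using nabla_along_torsion_free[OF u, of X Y] by simp
  have "linear (\<lambda>v. v - tangential g F u v)"
    by (rule linearI) (simp_all add: tangential_eq[OF u] bilinear_ladd[OF b] bilinear_lmul[OF b] algebra_simps)
  from linear_compose[OF linear_nabla_along[OF u differentiable_Der_F[OF u]] this]
  have lin: "linear (\<lambda>X. second_form g F u X Y)" for Y
    by (simp add: o_def second_form_def Let_def)
  show "bilinear (second_form g F u)"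
    unfolding bilinear_def using lin sym by auto
  show "second_form g F u X Y = second_form g F u Y X" by (rule sym)
qed

lemma minimal_second_form:
  assumes u: "u \<in> S" and H: "mean_curvature g F u = 0"
  shows "second_form g F u (e1 u) (e2 u) = 0"
proof -
  have "- (second_form g F u (e1 u) (e2 u) + second_form g F u (e2 u) (e1 u)) = 0"
    using H trace_null_frame[OF bilinear_induced[OF u] induced_sym[OF u] bilinear_second_form[OF u],
        of "e1 u" "e2 u"] frame u
    by (auto simp: mean_curvature_def Let_def null_frame_on_def)
  then have "second_form g F u (e1 u) (e2 u) + second_form g F u (e1 u) (e2 u) = 0"
    using second_form_sym[OF u, of "e2 u" "e1 u"] by simp
  then show ?thesis by (simp only: scaleR_2[symmetric]) simp
qed

text \<open>
  Differentiating a component function of the frame only adds tangent vectors, so that the normal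
  part of the derivative of \<open>E1\<close> in the direction \<open>e2\<close> is \<open>h(e2, e1)\<close>, and similarly for \<open>E2\<close>.
\<close>

lemma minimal_nabla_tangent:
  assumes u: "u \<in> S" and H: "mean_curvature g F u = 0"
  shows "nab u (e2 u) E1 \<in> tangent_space F u" "nab u (e1 u) E2 \<in> tangent_space F u"
proof -
  note l = linear_Der_F[OF u]
  have sub: "subspace (tangent_space F u)"
    unfolding tangent_space_def by (intro linear_subspace_image l subspace_UNIV)
  have T: "nab u X (\<lambda>w. Der F w Y) \<in> tangent_space F u" if "second_form g F u X Y = 0" for X Y
    using that tangential_in[OF u, of "nab u X (\<lambda>w. Der F w Y)"]
    by (simp add: second_form_def Let_def)
  have h: "second_form g F u (e1 u) (e2 u) = 0" by (rule minimal_second_form[OF assms])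
  then have h': "second_form g F u (e2 u) (e1 u) = 0" using second_form_sym[OF u] by metis
  have D: "Der F u X \<in> tangent_space F u" for X by (auto simp: tangent_space_def)
  show "nab u (e2 u) E1 \<in> tangent_space F u"
    unfolding E1_def nabla_along_tangent_field[OF u differentiable_e(1)[OF u]]
    by (rule subspace_add[OF sub T[OF h'] D])
  show "nab u (e1 u) E2 \<in> tangent_space F u"
    unfolding E2_def nabla_along_tangent_field[OF u differentiable_e(2)[OF u]]
    by (rule subspace_add[OF sub T[OF h] D])
qed

lemma frame_derivatives:
  assumes u: "u \<in> S"
  shows "g (F u) (nab u X E1) (E1 u) = 0" "g (F u) (nab u X E2) (E2 u) = 0"
    "g (F u) (nab u X E1) (E2 u) = - g (F u) (nab u X E2) (E1 u)"
  using nabla_along_metric_const[OF u differentiable_E(1)[OF u] differentiable_E(1)[OF u], of 0 X]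
    nabla_along_metric_const[OF u differentiable_E(2)[OF u] differentiable_E(2)[OF u], of 0 X]
    nabla_along_metric_const[OF u differentiable_E(1)[OF u] differentiable_E(2)[OF u], of "- 1" X]
    null_E metric_sym[OF F_in[OF u], of "E1 u"] metric_sym[OF F_in[OF u], of "E2 u"]
  by auto

text \<open>
  The form \<open>\<langle>J X, Y\<rangle>\<close> is alternating, hence on a plane determined by its value on one basis.
\<close>

lemma isotropic_if_slant_0:
  assumes u: "u \<in> S" and "g (F u) (J (E1 u)) (E2 u) = 0"
  shows "g (F u) (J (Der F u X)) (Der F u Y) = 0"
proof -
  interpret slant_null_pair "g (F u)" "E1 u" "E2 u" 0
    using hermitian[OF u] null_E[OF u] assms(2)
    by (simp add: slant_null_pair_def slant_null_pair_axioms_def)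
  show ?thesis
    by (subst tangent_expand[OF u, of X], subst tangent_expand[OF u, of Y]) (simp add: expand products)
qed

text \<open>
  The Codazzi argument. All covariant derivatives are taken in directions \<open>X\<close> that are constant in the
  parameter domain, so that no Lie brackets of the frame fields appear; they agree with \<open>e1\<close> and \<open>e2\<close>
  only at the point \<open>u\<close> where the curvature is evaluated.
\<close>

proposition minimal_slant_imp_sinh_angle_0:
  assumes minimal: "\<And>u. u \<in> S \<Longrightarrow> mean_curvature g F u = 0"
    and slant: "\<And>u. u \<in> S \<Longrightarrow> g (F u) (J (E1 u)) (E2 u) = - s"
    and curv: "\<And>p X Y Z. p \<in> U \<Longrightarrow> curvature g p X Y Z =
      c *\<^sub>R (g p Y Z *\<^sub>R X - g p X Z *\<^sub>R Y + g p (J Y) Z *\<^sub>R J X - g p (J X) Z *\<^sub>R J Y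
           + (2 * g p X (J Y)) *\<^sub>R J Z)"
    and c: "c \<noteq> 0" and ne: "S \<noteq> {}"
  shows "s = 0"
proof -
  have pair: "slant_null_pair (g (F u)) (E1 u) (E2 u) s" if "u \<in> S" for u
    using hermitian[OF that] null_E[OF that] slant[OF that]
    by (simp add: slant_null_pair_def slant_null_pair_axioms_def)
  define W where "W u = J (E2 u) + s *\<^sub>R E2 u" for u
  have dJE: "(\<lambda>w. J (E1 w)) differentiable (at u)" "(\<lambda>w. J (E2 w)) differentiable (at u)"
    "(\<lambda>w. s *\<^sub>R E2 w) differentiable (at u)" if "u \<in> S" for u
    using differentiable_E[OF that] differentiable_J by auto
  have dW: "W differentiable (at u)" if "u \<in> S" for u
    unfolding W_def using dJE[OF that] by (intro differentiable_add)
  have nabW: "nab u X W = J (nab u X E2) + s *\<^sub>R nab u X E2" if "u \<in> S" for u X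
    unfolding W_def
    using that by (simp add: nabla_along_add dJE differentiable_E nabla_along_J nabla_along_scaleR)
  have slant': "g (F u) (J (nab u X E1)) (E2 u) + g (F u) (J (E1 u)) (nab u X E2) = 0" if "u \<in> S" for u X
    using nabla_along_metric_const[OF that dJE(1)[OF that] differentiable_E(2)[OF that] slant, of X]
    by (simp add: nabla_along_J that differentiable_E)
  have nab1: "\<exists>a. nab u (e2 u) E1 = a *\<^sub>R E1 u" and nab2: "\<exists>a. nab u (e1 u) E2 = a *\<^sub>R E2 u"
    if u: "u \<in> S" for u
  proof -
    obtain X where X: "nab u (e2 u) E1 = Der F u X"
      using minimal_nabla_tangent(1)[OF u minimal[OF u]] by (auto simp: tangent_space_def)
    have "nab u (e2 u) E1 = (- g (F u) (Der F u X) (E2 u)) *\<^sub>R E1 u"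
      using tangent_expand[OF u, of X] frame_derivatives(1)[OF u, of "e2 u"] X by simp
    then show "\<exists>a. nab u (e2 u) E1 = a *\<^sub>R E1 u" by blast
    obtain X where X: "nab u (e1 u) E2 = Der F u X"
      using minimal_nabla_tangent(2)[OF u minimal[OF u]] by (auto simp: tangent_space_def)
    have "nab u (e1 u) E2 = (- g (F u) (Der F u X) (E1 u)) *\<^sub>R E2 u"
      using tangent_expand[OF u, of X] frame_derivatives(2)[OF u, of "e1 u"] X by simp
    then show "\<exists>a. nab u (e1 u) E2 = a *\<^sub>R E2 u" by blast
  qed
  \<comment> \<open>by linearity in \<open>X\<close>, it is enough to consider the two frame directions\<close>
  have normal_n2: "g (F u) (nab u X E1) (W u) = 0" if u: "u \<in> S" for u X
  proof -
    interpret slant_null_pair "g (F u)" "E1 u" "E2 u" s by (rule pair[OF u])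
    have W: "W u = n2" by (simp add: W_def n2_def)
    obtain a where a: "nab u (e2 u) E1 = a *\<^sub>R E1 u" using nab1[OF u] by blast
    obtain b where b: "nab u (e1 u) E2 = b *\<^sub>R E2 u" using nab2[OF u] by blast
    have "g (F u) (nab u (e1 u) E1) (E2 u) = b"
      using frame_derivatives(3)[OF u, of "e1 u"] by (simp add: b expand products)
    moreover have "g (F u) (nab u (e1 u) E1) (J (E2 u)) = - b * s"
      using slant'[OF u, of "e1 u"] J_skew[of "nab u (e1 u) E1" "E2 u"] by (simp add: b expand products)
    ultimately have 1: "g (F u) (nab u (e1 u) E1) (W u) = 0"
      by (simp add: W_def expand)
    have 2: "g (F u) (nab u (e2 u) E1) (W u) = 0"
      by (simp add: a W expand n_products)
    note l = linear_nabla_along[OF u differentiable_E(1)[OF u]]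
    obtain x y where "X = x *\<^sub>R e1 u + y *\<^sub>R e2 u"
      using frame_expand[OF u, of X] by (metis add_uminus_conv_diff scaleR_minus_left)
    then show ?thesis
      using 1 2 by (simp add: linear_add[OF l] linear_cmul[OF l] expand)
  qed
  obtain u where u: "u \<in> S" using ne by blast
  interpret slant_null_pair "g (F u)" "E1 u" "E2 u" s by (rule pair[OF u])
  have W: "W u = n2" by (simp add: W_def n2_def)
  \<comment> \<open>the identity \<open>normal_n2\<close> holds on all of \<open>S\<close> and can therefore be differentiated\<close>
  have commute_term: "g (F u) (nab u X (\<lambda>w. nab w Y E1)) (W u) = - g (F u) (nab u Y E1) (nab u X W)" for X Y
    using nabla_along_metric_const[OF u differentiable_nabla_along[OF u Ck_E(1)] dW[OF u] normal_n2, of X Y]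
    by simp
  define D1 D2 where "D1 = nab u (e1 u) E1" and "D2 = nab u (e2 u) E2"
  obtain a where a: "nab u (e2 u) E1 = a *\<^sub>R E1 u" using nab1[OF u] by blast
  obtain b where b: "nab u (e1 u) E2 = b *\<^sub>R E2 u" using nab2[OF u] by blast
  have "g (F u) D1 (J D2 + s *\<^sub>R D2) = 0"
  proof (rule codazzi_term_vanishes)
    show "g (F u) D1 (E1 u) = 0" "g (F u) D2 (E2 u) = 0"
      using frame_derivatives[OF u] by (simp_all add: D1_def D2_def)
    show "g (F u) D1 n2 = 0" using normal_n2[OF u] by (simp add: D1_def W)
    have "g (F u) D2 (E1 u) = a"
      using frame_derivatives(3)[OF u, of "e2 u"] by (simp add: a D2_def expand products)
    moreover have "g (F u) D2 (J (E1 u)) = a * s"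
      using slant'[OF u, of "e2 u"] commute[of D2 "J (E1 u)"] by (simp add: a D2_def expand products)
    ultimately show "g (F u) D2 n1 = 0" by (simp add: n1_def expand)
  qed
  then have "g (F u) (nab u (e1 u) E1) (nab u (e2 u) W) = 0"
    by (simp add: nabW[OF u] D1_def D2_def)
  moreover have "g (F u) (nab u (e2 u) E1) (nab u (e1 u) W) = 0"
    by (simp add: nabW[OF u] a b expand products)
  moreover have "curvature g (F u) (E1 u) (E2 u) (E1 u) =
      nab u (e1 u) (\<lambda>w. nab w (e2 u) E1) - nab u (e2 u) (\<lambda>w. nab w (e1 u) E1)"
    using nabla_along_commute[OF u Ck_E(1), of "e1 u" "e2 u"] by (simp add: E1_def E2_def)
  ultimately have "g (F u) (curvature g (F u) (E1 u) (E2 u) (E1 u)) (W u) = 0"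
    by (simp add: bilinear_lsub[OF bil] commute_term)
  then have "- 3 * c * s * (1 + s * s) = 0"
    unfolding curv[OF F_in[OF u]] W using curvature_term[of c] by simp
  moreover have "1 + s * s \<noteq> 0" using add_pos_nonneg[of 1 "s * s"] by simp
  ultimately show ?thesis using c by simp
qed

end

section \<open>Change of charts\<close>

lemma smooth_manifold_chart:
  assumes "smooth_manifold N B" "b \<in> B"
  shows "openin N (fst b)" "open (snd b ` fst b)" "inj_on (snd b) (fst b)" "fst b \<subseteq> topspace N"
proof -
  have *: "openin N (fst b)" "open (snd b ` fst b)"
    "homeomorphic_map (subtopology N (fst b)) (top_of_set (snd b ` fst b)) (snd b)"
    using assms by (auto simp: smooth_manifold_def)
  then show "openin N (fst b)" "open (snd b ` fst b)" "fst b \<subseteq> topspace N"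
    by (auto dest: openin_subset)
  then show "inj_on (snd b) (fst b)"
    using homeomorphic_imp_injective_map[OF *(3)] by (simp add: Int_absorb1)
qed

lemma open_chart_image:
  assumes N: "smooth_manifold N B" "b \<in> B" and T: "openin N T" "T \<subseteq> fst b"
  shows "open (snd b ` T)"
proof -
  have "homeomorphic_map (subtopology N (fst b)) (top_of_set (snd b ` fst b)) (snd b)"
    using N by (auto simp: smooth_manifold_def)
  then have "open_map (subtopology N (fst b)) (top_of_set (snd b ` fst b)) (snd b)"
    by (rule homeomorphic_imp_open_map)
  moreover have "openin (subtopology N (fst b)) T"
    using T by (auto simp: openin_subtopology)
  ultimately have "openin (top_of_set (snd b ` fst b)) (snd b ` T)"
    by (auto simp: open_map_def)
  then show ?thesis
    using smooth_manifold_chart(2)[OF N] by (rule openin_open_trans)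
qed

lemma transition_apply:
  "inj_on (snd a) (fst a) \<Longrightarrow> x \<in> fst a \<Longrightarrow> transition a a' (snd a x) = snd a' x"
  by (simp add: transition_def)

lemma local_rep_apply:
  "inj_on (snd b) (fst b) \<Longrightarrow> x \<in> fst b \<Longrightarrow> local_rep a b f (snd b x) = snd a (f x)"
  by (simp add: local_rep_def)

text \<open>
  In a neighbourhood of \<open>x\<close> the two coordinate expressions of \<open>f\<close> differ by the transition maps of both
  manifolds; the chain rule does the rest.
\<close>

lemma Der_local_rep_change:
  assumes M: "smooth_manifold M A" and im: "immersed_surface M A N B f"
    and a: "a \<in> A" "a' \<in> A" and b: "b \<in> B" "b' \<in> B"
    and x: "x \<in> fst b" "x \<in> fst b'" "f x \<in> fst a" "f x \<in> fst a'"
  shows "Der (local_rep a b f) (snd b x) X =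
    Der (transition a' a) (snd a' (f x)) (Der (local_rep a' b' f) (snd b' x) (Der (transition b b') (snd b x) X))"
proof -
  have N: "smooth_manifold N B" and f: "continuous_map N M f"
    using im by (auto simp: immersed_surface_def)
  note cN = smooth_manifold_chart[OF N] and cM = smooth_manifold_chart[OF M]
  define T where "T = fst b \<inter> fst b' \<inter> {y \<in> topspace N. f y \<in> fst a} \<inter> {y \<in> topspace N. f y \<in> fst a'}"
  have "openin N T"
    unfolding T_def by (intro openin_Int cN b openin_continuous_map_preimage[OF f] cM a)
  then have T: "open (snd b ` T)" by (rule open_chart_image[OF N b(1)]) (auto simp: T_def)
  have xT: "snd b x \<in> snd b ` T" using x cN(4)[OF b(1)] by (auto simp: T_def)
  let ?\<phi> = "transition b b'" and ?\<psi> = "transition a' a" and ?F = "local_rep a' b' f"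
  have "smooth_on (overlap b b') ?\<phi>" "smooth_on (overlap a' a) ?\<psi>"
    using M N a b by (auto simp: smooth_manifold_def)
  then have "?\<phi> differentiable (at (snd b x))" "?\<psi> differentiable (at (snd a' (f x)))"
    using x by (auto simp: overlap_def intro!: smooth_on_differentiable)
  then have \<phi>: "(?\<phi> has_derivative Der ?\<phi> (snd b x)) (at (snd b x))"
    and \<psi>: "(?\<psi> has_derivative Der ?\<psi> (snd a' (f x))) (at (snd a' (f x)))"
    by (auto intro: has_derivative_Der)
  have "smooth_on (local_dom a' b' f) ?F" using im a b by (auto simp: immersed_surface_def)
  then have "?F differentiable (at (snd b' x))"
    using x by (auto simp: local_dom_def intro!: smooth_on_differentiable)
  then have F: "(?F has_derivative Der ?F (snd b' x)) (at (snd b' x))"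
    by (rule has_derivative_Der)
  have p: "?\<phi> (snd b x) = snd b' x" "?F (snd b' x) = snd a' (f x)"
    using x cN(3) b by (auto simp: transition_apply local_rep_apply)
  have "((\<lambda>w. ?\<psi> (?F (?\<phi> w))) has_derivative
    (\<lambda>X. Der ?\<psi> (snd a' (f x)) (Der ?F (snd b' x) (Der ?\<phi> (snd b x) X)))) (at (snd b x))"
    using has_derivative_compose[OF has_derivative_compose[OF \<phi> F[folded p(1)]], of ?\<psi>] \<psi>
    by (simp add: p)
  then have "(local_rep a b f has_derivative
    (\<lambda>X. Der ?\<psi> (snd a' (f x)) (Der ?F (snd b' x) (Der ?\<phi> (snd b x) X)))) (at (snd b x))"
  proof (rule has_derivative_transform_within_open[OF _ T xT])
    fix w assume "w \<in> snd b ` T"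
    then obtain y where y: "w = snd b y" "y \<in> T" by blast
    then show "?\<psi> (?F (?\<phi> w)) = local_rep a b f w"
      using cN(3) cM(3) a b by (auto simp: T_def transition_apply local_rep_apply)
  qed
  then show ?thesis by (rule Der_eqI)
qed

text \<open>
  For an isotropic nondegenerate plane, \<open>T\<close> is the complex linear extension of \<open>L\<close>. It is injective,
  because pairing \<open>T Z\<close> with the plane recovers the real part of \<open>Z\<close>, and if that is zero then pairing
  \<open>J (T Z)\<close> recovers the imaginary part. Hence it is onto, and if \<open>T Z\<close> is orthogonal to the plane then \<open>Z\<close>
  is purely imaginary.
\<close>

lemma (in hermitian_product) lagrangian_plane:
  fixes L :: "real^2 \<Rightarrow> complex^2"
  assumes L: "linear L" and nondeg: "scalar_product (\<lambda>X Y. b (L X) (L Y))"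
    and isotropic: "\<And>X Y. b (J (L X)) (L Y) = 0"
  shows "J ` range L = {\<xi>. \<forall>t\<in>range L. b \<xi> t = 0}"
proof (rule set_eqI, rule iffI)
  fix \<xi> assume "\<xi> \<in> J ` range L"
  then show "\<xi> \<in> {\<xi>. \<forall>t\<in>range L. b \<xi> t = 0}" using isotropic by auto
next
  fix \<xi> assume \<xi>: "\<xi> \<in> {\<xi>. \<forall>t\<in>range L. b \<xi> t = 0}"
  define T :: "complex^2 \<Rightarrow> complex^2" where
    "T Z = L (\<chi> i. Re (Z $ i)) + J (L (\<chi> i. Im (Z $ i)))" for Z
  have bT: "b (T Z) (L Y) = b (L (\<chi> i. Re (Z $ i))) (L Y)" for Z Y
    by (simp add: T_def expand isotropic)
  have zero: "X = 0" if "\<And>Y. b (L X) (L Y) = 0" for X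
    using scalar_productD(3)[OF nondeg] that by blast
  have T: "linear T"
  proof (rule linearI)
    have "(\<chi> i. Re ((X + Y) $ i)) = (\<chi> i. Re (X $ i)) + (\<chi> i. Re (Y $ i))"
      "(\<chi> i. Im ((X + Y) $ i)) = (\<chi> i. Im (X $ i)) + (\<chi> i. Im (Y $ i))" for X Y :: "complex^2"
      by (simp_all add: vec_eq_iff)
    then show "T (X + Y) = T X + T Y" for X Y
      by (simp add: T_def linear_add[OF L] del: plus_vec_def vector_add_component)
    have "(\<chi> i. Re ((r *\<^sub>R X) $ i)) = r *\<^sub>R (\<chi> i. Re (X $ i))"
      "(\<chi> i. Im ((r *\<^sub>R X) $ i)) = r *\<^sub>R (\<chi> i. Im (X $ i))" for r and X :: "complex^2"
      by (simp_all add: vec_eq_iff)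
    then show "T (r *\<^sub>R X) = r *\<^sub>R T X" for r X
      by (simp add: T_def linear_cmul[OF L] scaleR_add_right del: vector_scaleR_component)
  qed
  have "inj T"
    unfolding linear_injective_0[OF T]
  proof (intro allI impI)
    fix Z assume Z: "T Z = 0"
    have Re: "(\<chi> i. Re (Z $ i)) = 0"
      using bT[of Z] by (intro zero) (simp add: Z expand)
    then have "J (L (\<chi> i. Im (Z $ i))) = 0"
      using Z by (simp add: T_def linear_0[OF L])
    then have "J (J (L (\<chi> i. Im (Z $ i)))) = 0" by (simp add: J_def)
    then have "L (\<chi> i. Im (Z $ i)) = 0" by simp
    then have "(\<chi> i. Im (Z $ i)) = 0"
      by (intro zero) (simp add: expand)
    with Re show "Z = 0" by (simp add: vec_eq_iff complex_eq_iff)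
  qed
  then have "surj T" using T by (rule linear_inj_imp_surj[rotated])
  then obtain Z where Z: "\<xi> = T Z" by (metis surjD)
  have "(\<chi> i. Re (Z $ i)) = 0"
    using \<xi> bT[of Z] by (intro zero) (simp add: Z)
  then have "\<xi> = J (L (\<chi> i. Im (Z $ i)))" by (simp add: Z T_def linear_0[OF L])
  then show "\<xi> \<in> J ` range L" by blast
qed

section \<open>Minimal slant surfaces are Lagrangian\<close>

lemma lorentzian_kaehlerD:
  assumes K: "lorentzian_kaehler M A g" and a: "a \<in> A"
  shows "metric_domain (snd a ` fst a) (g a)"
    and "p \<in> snd a ` fst a \<Longrightarrow> hermitian_product (g a p)"
    and "p \<in> snd a ` fst a \<Longrightarrow> g a p (J X) (J Y) = g a p X Y"
    and "p \<in> snd a ` fst a \<Longrightarrow> christoffel (g a) p X (J Y) = J (christoffel (g a) p X Y)"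
proof -
  have metric: "metric_on (snd a ` fst a) (g a)" and M: "smooth_manifold M A"
    using K a by (auto simp: lorentzian_kaehler_def pseudo_riemannian_def)
  then show "metric_domain (snd a ` fst a) (g a)"
    using smooth_manifold_chart(2)[OF M a] by (simp add: metric_domain_def)
  show iso: "g a p (J X) (J Y) = g a p X Y" if "p \<in> snd a ` fst a" for p X Y
    using K a that by (auto simp: lorentzian_kaehler_def)
  show "hermitian_product (g a p)" if "p \<in> snd a ` fst a"
    using iso[OF that] metric that unfolding hermitian_product_def metric_on_def by blast
  have "smooth_on (snd a ` fst a) (\<lambda>_. Y)"
    by (simp add: smooth_on_def Ck_on_const)
  then have "nabla (g a) p X (\<lambda>q. J Y) = J (nabla (g a) p X (\<lambda>_. Y))" if "p \<in> snd a ` fst a"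
    using K a that unfolding lorentzian_kaehler_def by blast
  then show "christoffel (g a) p X (J Y) = J (christoffel (g a) p X Y)" if "p \<in> snd a ` fst a"
    using that by (simp add: nabla_def)
qed

text \<open>
  The Kaehler form vanishes on the tangent plane at \<open>x\<close>, expressed in the charts in which slantness
  provides a frame.
\<close>

lemma minimal_slant_isotropic_near:
  assumes form: "lorentzian_complex_space_form M A g c" and c: "c \<noteq> 0"
    and im: "immersed_surface M A N B f" and minimal: "minimal_surface A g B f"
    and slant: "slant_surface A g N B f" and x: "x \<in> topspace N"
  shows "\<exists>a\<in>A. \<exists>b\<in>B. x \<in> fst b \<and> f x \<in> fst a \<and>
    (\<forall>X Y. g a (snd a (f x)) (J (Der (local_rep a b f) (snd b x) X)) (Der (local_rep a b f) (snd b x) Y) = 0)"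
proof -
  obtain \<alpha> a b S e1 e2 where a: "a \<in> A" and b: "b \<in> B" and xab: "x \<in> fst b" "f x \<in> fst a"
    and S: "open S" "snd b x \<in> S" "S \<subseteq> local_dom a b f"
    and frame: "null_frame_on (g a) (local_rep a b f) S e1 e2"
    and angle: "wirtinger_angle_on (g a) (local_rep a b f) S e1 e2 (\<lambda>_. \<alpha>)"
    using slant x unfolding slant_surface_def by blast
  have K: "lorentzian_kaehler M A g"
    and curv: "\<And>p X Y Z. p \<in> snd a ` fst a \<Longrightarrow> curvature (g a) p X Y Z =
      c *\<^sub>R (g a p Y Z *\<^sub>R X - g a p X Z *\<^sub>R Y + g a p (J Y) Z *\<^sub>R J X - g a p (J X) Z *\<^sub>R J Y
           + (2 * g a p X (J Y)) *\<^sub>R J Z)"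
    using form a unfolding lorentzian_complex_space_form_def by auto
  note kd = lorentzian_kaehlerD[OF K a]
  interpret metric_domain "snd a ` fst a" "g a" by (rule kd)
  let ?F = "local_rep a b f"
  have inj: "inj_on (snd b) (fst b)"
    using im smooth_manifold_chart(3)[OF _ b] unfolding immersed_surface_def by blast
  have "smooth_on (local_dom a b f) ?F" using im a b by (auto simp: immersed_surface_def)
  then have smooth: "smooth_on S ?F"
    using S Ck_on_subset unfolding smooth_on_def by blast
  have in_U: "?F u \<in> snd a ` fst a" if "u \<in> S" for u
    using that S inj by (auto simp: local_dom_def local_rep_apply)
  interpret null_framed_surface "snd a ` fst a" "g a" S ?F e1 e2
    by unfold_locales (use S smooth in_U kd frame in auto)
  have angle': "g a (?F u) (J (E1 u)) (E2 u) = - sinh \<alpha>" if "u \<in> S" for u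
    using angle that by (intro wirtinger_angle) (auto simp: wirtinger_angle_on_def E1_def)
  have "sinh \<alpha> = 0"
  proof (rule minimal_slant_imp_sinh_angle_0[OF _ angle' curv c])
    show "mean_curvature (g a) ?F u = 0" if "u \<in> S" for u
      using minimal a b that S by (auto simp: minimal_surface_def)
  qed (use S in auto)
  then have "g a (?F (snd b x)) (J (Der ?F (snd b x) X)) (Der ?F (snd b x) Y) = 0" for X Y
    using isotropic_if_slant_0[OF S(2)] angle'[OF S(2)] by simp
  moreover have "?F (snd b x) = snd a (f x)" using xab inj by (simp add: local_rep_apply)
  ultimately show ?thesis using a b xab by metis
qed

theorem lemma6p1:
  fixes M :: "'m topology"
    and A :: "('m, complex^2) chart set"
    and g :: "('m, complex^2) chart \<Rightarrow> (complex^2) metric"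
    and c :: real
    and N :: "'n topology"
    and B :: "('n, real^2) chart set"
    and f :: "'n \<Rightarrow> 'm"
  assumes "lorentzian_complex_space_form M A g c"
    and "c \<noteq> 0"
    and "lorentzian_surface M A g N B f"
    and "minimal_surface A g B f"
    and "flat_surface A g B f"
    and "slant_surface A g N B f"
  shows "lagrangian_surface A g B f"
  unfolding lagrangian_surface_def
proof (intro ballI)
  fix a b u assume a: "a \<in> A" and b: "b \<in> B" and u: "u \<in> local_dom a b f"
  have K: "lorentzian_kaehler M A g"
    using assms(1) by (simp add: lorentzian_complex_space_form_def)
  then have M: "smooth_manifold M A"
    and J_Der: "\<And>a b p X. a \<in> A \<Longrightarrow> b \<in> A \<Longrightarrow> p \<in> overlap a b \<Longrightarrow>
      Der (transition a b) p (J X) = J (Der (transition a b) p X)"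
    and g_Der: "\<And>a b p X Y. a \<in> A \<Longrightarrow> b \<in> A \<Longrightarrow> p \<in> overlap a b \<Longrightarrow>
      g a p X Y = g b (transition a b p) (Der (transition a b) p X) (Der (transition a b) p Y)"
    by (auto simp: lorentzian_kaehler_def complex_surface_def pseudo_riemannian_def)
  have im: "immersed_surface M A N B f"
    using assms(3) by (simp add: lorentzian_surface_def)
  then have N: "smooth_manifold N B" by (simp add: immersed_surface_def)
  obtain x where x: "u = snd b x" "x \<in> fst b" "f x \<in> fst a"
    using u by (auto simp: local_dom_def)
  have "x \<in> topspace N" using smooth_manifold_chart(4)[OF N b] x by blast
  from minimal_slant_isotropic_near[OF assms(1,2) im assms(4,6) this]
  obtain a' b' where a': "a' \<in> A" and b': "b' \<in> B" and x': "x \<in> fst b'" "f x \<in> fst a'"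
    and iso: "\<And>X Y. g a' (snd a' (f x)) (J (Der (local_rep a' b' f) (snd b' x) X))
      (Der (local_rep a' b' f) (snd b' x) Y) = 0"
    by blast
  let ?F = "local_rep a b f"
  have Fu: "?F u = snd a (f x)"
    using x smooth_manifold_chart(3)[OF N b] by (simp add: local_rep_apply)
  have ov: "snd a' (f x) \<in> overlap a' a" using x x' by (auto simp: overlap_def)
  have tr: "transition a' a (snd a' (f x)) = snd a (f x)"
    using x' smooth_manifold_chart(3)[OF M a'] by (simp add: transition_apply)
  have "g a (?F u) (J (Der ?F u X)) (Der ?F u Y) = 0" for X Y
    unfolding x(1) Der_local_rep_change[OF M im a a' b b' x(2) x'(1) x(3) x'(2)]
      J_Der[OF a' a ov, symmetric] Fu[unfolded x(1)] tr[symmetric] g_Der[OF a' a ov, symmetric]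
    by (rule iso)
  moreover have "linear (Der ?F u)"
    using im a b u by (intro linear_Der smooth_on_differentiable) (auto simp: immersed_surface_def)
  moreover have "scalar_product (\<lambda>X Y. g a (?F u) (Der ?F u X) (Der ?F u Y))"
    using assms(3) a b u by (auto simp: lorentzian_surface_def induced_metric_def[abs_def])
  moreover have "hermitian_product (g a (?F u))"
    using lorentzian_kaehlerD(2)[OF K a] x Fu by auto
  ultimately show "J ` tangent_space ?F u = normal_space (g a) ?F u"
    unfolding tangent_space_def normal_space_def by (intro hermitian_product.lagrangian_plane)
qed

end
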